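(* Let $\alpha_1,\alpha_4\in\mathbb{F}_{p^m}^*$ be such that $\alpha_1+\alpha_4uv$ is not a cube in $\mathcal{R}$. Then the ring $R_{\alpha_1,\alpha_4}=\frac{\mathcal{R}[x]}{\langle x^{3p^s}-(\alpha_1+\alpha_4uv)\rangle}$ is a local ring with unique maximal ideal $\langle(x^3-\alpha_0),u,v\rangle$, but $R_{\alpha_1,\alpha_4}$ is not a chain ring.
   Context: $p\neq3$ is a prime, $m,s$ are positive integers, and $\mathcal{R}=\frac{\mathbb{F}_{p^m}[u,v]}{\langle u^2,v^2,uv-vu\rangle}=\mathbb{F}_{p^m}+u\mathbb{F}_{p^m}+v\mathbb{F}_{p^m}+uv\mathbb{F}_{p^m}$ with $u^2=v^2=0$, $uv=vu$. Writing $s=q_0m+r_0$ with $q_0\ge0$ and $0\le r_0\le m-1$, put $\alpha_0=\alpha_1^{p^{m-r_0}}$, so that $\alpha_0^{p^s}=\alpha_1$. A finite commutative ring with identity is a chain ring if the set of all its ideals is totally ordered by inclusion. *)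

theory Defs
  imports "HOL-Algebra.Algebra"
begin

text \<open>
  F[u, v] is rendered as F[u][v], i.e. \<^const>\<open>UP\<close> applied twice: \<open>u\<close> is the variable of the inner
  polynomial ring, seen as a constant of the outer one, and \<open>v\<close> is the variable of the outer one.
\<close>

abbreviation Fuv :: "('a, 'b) ring_scheme \<Rightarrow> (nat \<Rightarrow> 'a, nat \<Rightarrow> nat \<Rightarrow> 'a) up_ring"
  where "Fuv F \<equiv> UP (UP F)"

definition Fuv_const :: "('a, 'b) ring_scheme \<Rightarrow> 'a \<Rightarrow> nat \<Rightarrow> nat \<Rightarrow> 'a"
  where "Fuv_const F a = monom (Fuv F) (monom (UP F) a 0) 0"

definition Fuv_u :: "('a, 'b) ring_scheme \<Rightarrow> nat \<Rightarrow> nat \<Rightarrow> 'a"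
  where "Fuv_u F = monom (Fuv F) (monom (UP F) \<one>\<^bsub>F\<^esub> 1) 0"

definition Fuv_v :: "('a, 'b) ring_scheme \<Rightarrow> nat \<Rightarrow> nat \<Rightarrow> 'a"
  where "Fuv_v F = monom (Fuv F) \<one>\<^bsub>UP F\<^esub> 1"

definition uv_ideal :: "('a, 'b) ring_scheme \<Rightarrow> (nat \<Rightarrow> nat \<Rightarrow> 'a) set"
  where "uv_ideal F = Idl\<^bsub>Fuv F\<^esub>
    {Fuv_u F [^]\<^bsub>Fuv F\<^esub> (2::nat),
     Fuv_v F [^]\<^bsub>Fuv F\<^esub> (2::nat),
     (Fuv_u F \<otimes>\<^bsub>Fuv F\<^esub> Fuv_v F) \<ominus>\<^bsub>Fuv F\<^esub> (Fuv_v F \<otimes>\<^bsub>Fuv F\<^esub> Fuv_u F)}"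

definition Ruv :: "('a, 'b) ring_scheme \<Rightarrow> (nat \<Rightarrow> nat \<Rightarrow> 'a) set ring"
  where "Ruv F = Fuv F Quot uv_ideal F"

definition Ruv_const :: "('a, 'b) ring_scheme \<Rightarrow> 'a \<Rightarrow> (nat \<Rightarrow> nat \<Rightarrow> 'a) set"
  where "Ruv_const F a = uv_ideal F +>\<^bsub>Fuv F\<^esub> Fuv_const F a"

definition Ruv_u :: "('a, 'b) ring_scheme \<Rightarrow> (nat \<Rightarrow> nat \<Rightarrow> 'a) set"
  where "Ruv_u F = uv_ideal F +>\<^bsub>Fuv F\<^esub> Fuv_u F"

definition Ruv_v :: "('a, 'b) ring_scheme \<Rightarrow> (nat \<Rightarrow> nat \<Rightarrow> 'a) set"
  where "Ruv_v F = uv_ideal F +>\<^bsub>Fuv F\<^esub> Fuv_v F"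

definition elem_uv :: "('a, 'b) ring_scheme \<Rightarrow> 'a \<Rightarrow> 'a \<Rightarrow> (nat \<Rightarrow> nat \<Rightarrow> 'a) set"
  where "elem_uv F \<alpha>1 \<alpha>4 =
    Ruv_const F \<alpha>1 \<oplus>\<^bsub>Ruv F\<^esub> (Ruv_const F \<alpha>4 \<otimes>\<^bsub>Ruv F\<^esub> Ruv_u F \<otimes>\<^bsub>Ruv F\<^esub> Ruv_v F)"

definition is_cube :: "('a, 'b) ring_scheme \<Rightarrow> 'a \<Rightarrow> bool"
  where "is_cube R a \<longleftrightarrow> (\<exists>c \<in> carrier R. c [^]\<^bsub>R\<^esub> (3::nat) = a)"

definition binomial_poly :: "('a, 'b) ring_scheme \<Rightarrow> nat \<Rightarrow> 'a \<Rightarrow> nat \<Rightarrow> 'a" \<comment> \<open>\<open>x\<^sup>n - c\<close>\<close>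
  where "binomial_poly R n c = monom (UP R) \<one>\<^bsub>R\<^esub> n \<ominus>\<^bsub>UP R\<^esub> monom (UP R) c 0"

definition constacyclic_ideal ::
    "('a, 'b) ring_scheme \<Rightarrow> nat \<Rightarrow> 'a \<Rightarrow> 'a \<Rightarrow> (nat \<Rightarrow> (nat \<Rightarrow> nat \<Rightarrow> 'a) set) set"
  where "constacyclic_ideal F N \<alpha>1 \<alpha>4 = Idl\<^bsub>UP (Ruv F)\<^esub> {binomial_poly (Ruv F) N (elem_uv F \<alpha>1 \<alpha>4)}"

definition constacyclic_ring ::
    "('a, 'b) ring_scheme \<Rightarrow> nat \<Rightarrow> 'a \<Rightarrow> 'a \<Rightarrow> (nat \<Rightarrow> (nat \<Rightarrow> nat \<Rightarrow> 'a) set) set ring"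
  where "constacyclic_ring F N \<alpha>1 \<alpha>4 = UP (Ruv F) Quot constacyclic_ideal F N \<alpha>1 \<alpha>4"

definition constacyclic_class ::
    "('a, 'b) ring_scheme \<Rightarrow> nat \<Rightarrow> 'a \<Rightarrow> 'a \<Rightarrow> (nat \<Rightarrow> (nat \<Rightarrow> nat \<Rightarrow> 'a) set) \<Rightarrow>
      (nat \<Rightarrow> (nat \<Rightarrow> nat \<Rightarrow> 'a) set) set"
  where "constacyclic_class F N \<alpha>1 \<alpha>4 f = constacyclic_ideal F N \<alpha>1 \<alpha>4 +>\<^bsub>UP (Ruv F)\<^esub> f"

definition local_ring :: "('a, 'b) ring_scheme \<Rightarrow> bool"
  where "local_ring R \<longleftrightarrow> cring R \<and> (\<exists>!M. maximalideal M R)"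

definition chain_ring :: "('a, 'b) ring_scheme \<Rightarrow> bool"
  where "chain_ring R \<longleftrightarrow> cring R \<and> finite (carrier R) \<and>
    (\<forall>I J. ideal I R \<longrightarrow> ideal J R \<longrightarrow> I \<subseteq> J \<or> J \<subseteq> I)"

end

theory Submission
  imports Defs
begin

text \<open>
Write \<open>R\<close> for \<open>F[u, v]\<close> modulo \<open>u\<^sup>2\<close> and \<open>v\<^sup>2\<close>, and \<open>A\<close> for the quotient of \<open>R[x]\<close> by
\<open>x ^ (3 p ^ s) - (\<alpha>1 + \<alpha>4 uv)\<close>.

The field \<open>F\<close> has characteristic \<open>p\<close>, so \<open>A\<close> has too, and raising to the power \<open>p ^ s\<close> is additive on
\<open>A\<close>. Since \<open>\<alpha>0 ^ (p ^ s) = \<alpha>1\<close>, it takes \<open>x\<^sup>3 - \<alpha>0\<close> to \<open>x ^ (3 p ^ s) - \<alpha>1 = \<alpha>4 uv\<close>, whose square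
is zero. So the three generators \<open>x\<^sup>3 - \<alpha>0\<close>, \<open>u\<close> and \<open>v\<close> of the ideal \<open>M\<close> in question are nilpotent.
Every maximal ideal contains them, and therefore \<open>A\<close> is local with maximal ideal \<open>M\<close> as soon as \<open>M\<close>
itself is maximal (\<open>nilpotent_generated_maximal_unique\<close>).

For that, \<open>M\<close> is proper because it lies in the nilradical, and every element of \<open>A\<close> is congruent modulo
\<open>M\<close> to a polynomial over \<open>F\<close>. So \<open>M\<close> is maximal if \<open>\<langle>x\<^sup>3 - \<alpha>0\<rangle>\<close> is a maximal ideal of \<open>F[x]\<close>
(\<open>maximalideal_image_modulo\<close>), and this holds once the cubic \<open>x\<^sup>3 - \<alpha>0\<close> has no root in \<open>F\<close>
(\<open>non_cube_maximal\<close>). If \<open>\<alpha>0\<close> were a cube, then so would be \<open>\<alpha>1 = c\<^sup>3\<close> with \<open>c \<noteq> 0\<close>; as 3 is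
invertible for \<open>p \<noteq> 3\<close>, also \<open>\<alpha>1 + \<alpha>4 uv = (c + t uv)\<^sup>3\<close> with \<open>t = \<alpha>4 / (3 c\<^sup>2)\<close> would be a cube in
\<open>R\<close> (\<open>elem_uv_is_cube\<close>), contrary to the hypothesis.

Finally, \<open>uv\<close> is nonzero in \<open>R\<close>, and it stays nonzero in \<open>A\<close> because a monic polynomial of positive
degree has no nonzero constant multiple (\<open>const_mem_binomial_ideal\<close>). With \<open>u\<^sup>2 = v\<^sup>2 = 0\<close> this makes
the principal ideals of \<open>u\<close> and \<open>v\<close> incomparable (\<open>not_chain_ring_if_square_zero\<close>).
\<close>

section \<open>Frobenius and nilpotents in characteristic p\<close>

lemma (in cring) binomial_theorem:
  assumes a: "a \<in> carrier R" and b: "b \<in> carrier R"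
  shows "(a \<oplus> b) [^] n = (\<Oplus>k\<in>{..n}. add_pow R (n choose k) (a [^] k \<otimes> b [^] (n - k)))"
proof (induction n)
  case 0
  then show ?case using a b by simp
next
  case (Suc n)
  define t where "t k = a [^] k \<otimes> b [^] (n - k)" for k
  define t' where "t' k = a [^] Suc k \<otimes> b [^] (n - k)" for k
  have t: "t k \<in> carrier R" and t': "t' k \<in> carrier R" for k
    using a b by (simp_all add: t_def t'_def)
  have at: "(add_pow R (n choose k) (t k)) \<otimes> a = add_pow R (n choose k) (t' k)" for k
  proof -
    have "t k \<otimes> a = t' k"
      using a b by (simp add: t_def t'_def m_ac)
    then show ?thesis using a t by (simp add: add_pow_ldistr)
  qed
  have bt: "(add_pow R (n choose k) (t k)) \<otimes> b = add_pow R (n choose k) (a [^] k \<otimes> b [^] (Suc n - k))" if "k \<le> n" for k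
  proof -
    have "t k \<otimes> b = a [^] k \<otimes> b [^] (Suc n - k)"
      using a b that by (simp add: t_def m_assoc Suc_diff_le)
    then show ?thesis using b t by (simp add: add_pow_ldistr)
  qed
  have "(\<Oplus>k\<in>{..n}. add_pow R (n choose k) (t k)) \<otimes> b =
      (\<Oplus>k\<in>{..n}. (add_pow R (n choose k) (t k)) \<otimes> b)"
    using t b by (intro finsum_ldistr) auto
  also have "\<dots> = (\<Oplus>k\<in>{..n}. add_pow R (n choose k) (a [^] k \<otimes> b [^] (Suc n - k)))"
    by (rule finsum_cong') (use a b bt in auto)
  also have "\<dots> = (\<Oplus>k\<in>{..Suc n}. add_pow R (n choose k) (a [^] k \<otimes> b [^] (Suc n - k)))"
    using a b by (subst finsum_Suc) (auto simp: binomial_eq_0)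
  also have "\<dots> = (\<Oplus>k\<in>{..n}. add_pow R (n choose Suc k) (t' k)) \<oplus> b [^] Suc n"
    using a b by (subst finsum_Suc2) (auto simp: t'_def)
  finally have B: "(\<Oplus>k\<in>{..n}. add_pow R (n choose k) (t k)) \<otimes> b =
      (\<Oplus>k\<in>{..n}. add_pow R (n choose Suc k) (t' k)) \<oplus> b [^] Suc n" .
  have A: "(\<Oplus>k\<in>{..n}. add_pow R (n choose k) (t k)) \<otimes> a = (\<Oplus>k\<in>{..n}. add_pow R (n choose k) (t' k))"
    using t a at by (subst finsum_ldistr) auto
  have T: "(\<Oplus>k\<in>{..n}. add_pow R (n choose k) (t k)) \<in> carrier R"
    using t by (intro finsum_closed) auto
  have "(a \<oplus> b) [^] Suc n = (\<Oplus>k\<in>{..n}. add_pow R (n choose k) (t k)) \<otimes> (a \<oplus> b)"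
    using Suc.IH by (simp add: t_def)
  also have "\<dots> = (\<Oplus>k\<in>{..n}. add_pow R (n choose k) (t' k)) \<oplus>
      ((\<Oplus>k\<in>{..n}. add_pow R (n choose Suc k) (t' k)) \<oplus> b [^] Suc n)"
    using r_distr[OF a b T] A B by simp
  also have "\<dots> = (\<Oplus>k\<in>{..n}. add_pow R (n choose k) (t' k) \<oplus> add_pow R (n choose Suc k) (t' k)) \<oplus> b [^] Suc n"
    using t' b by (subst finsum_addf) (auto simp: a_assoc)
  also have "\<dots> = (\<Oplus>k\<in>{..n}. add_pow R (Suc n choose Suc k) (t' k)) \<oplus> b [^] Suc n"
    using t' by (simp add: add.nat_pow_mult)
  also have "\<dots> = (\<Oplus>k\<in>{..Suc n}. add_pow R (Suc n choose k) (a [^] k \<otimes> b [^] (Suc n - k)))"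
    using a b by (subst finsum_Suc2) (auto simp: t'_def)
  finally show ?case .
qed

lemma (in cring) char_p_multiple_eq_zero:
  fixes p k :: nat
  assumes ch: "add_pow R p \<one> = \<zero>" and "p dvd k" and x: "x \<in> carrier R"
  shows "add_pow R k x = \<zero>"
proof -
  obtain j where k: "k = p * j" using assms by blast
  have "add_pow R p x = (add_pow R p \<one>) \<otimes> x" using x by (simp add: add_pow_ldistr)
  then have "add_pow R p x = \<zero>" using ch x by simp
  then show ?thesis using x by (simp add: k add.nat_pow_pow [symmetric])
qed

text \<open>
Every middle term of the binomial expansion carries a coefficient divisible by \<open>p\<close>.
\<close>
lemma (in cring) frobenius_add:
  fixes p :: nat
  assumes p: "Factorial_Ring.prime p" and ch: "add_pow R p \<one> = \<zero>"
    and a: "a \<in> carrier R" and b: "b \<in> carrier R"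
  shows "(a \<oplus> b) [^] p = a [^] p \<oplus> b [^] p"
proof -
  have p0: "p \<noteq> 0" using p by auto
  then obtain q where q: "p = Suc q" using not0_implies_Suc by blast
  have vanish: "add_pow R (p choose Suc k) x = \<zero>" if "k < q" "x \<in> carrier R" for k x
  proof (rule char_p_multiple_eq_zero[OF ch])
    show "p dvd p choose Suc k" using that p q by (intro dvd_choose_prime) auto
  qed (rule that)
  define t where "t k = add_pow R (p choose k) (a [^] k \<otimes> b [^] (p - k))" for k
  have t: "t k \<in> carrier R" for k using a b by (simp add: t_def)
  have "(a \<oplus> b) [^] p = (\<Oplus>k\<in>{..p}. t k)" unfolding t_def by (rule binomial_theorem[OF a b])
  also have "\<dots> = t p \<oplus> (\<Oplus>k\<in>{..q}. t k)" unfolding q using t by simp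
  also have "(\<Oplus>k\<in>{..q}. t k) = (\<Oplus>k\<in>{..q}. if k = 0 then t 0 else \<zero>)"
  proof (rule finsum_cong')
    fix k assume "k \<in> {..q}"
    then show "t k = (if k = 0 then t 0 else \<zero>)"
      using vanish[of "k - 1"] a b unfolding t_def by (cases k) auto
  qed (use t in auto)
  also have "\<dots> = t 0"
    using t by (subst add.finprod_singleton_swap) auto
  finally show ?thesis using a b by (simp add: t_def)
qed

lemma (in cring) frobenius_add_power:
  fixes p :: nat
  assumes p: "Factorial_Ring.prime p" and ch: "add_pow R p \<one> = \<zero>"
    and a: "a \<in> carrier R" and b: "b \<in> carrier R"
  shows "(a \<oplus> b) [^] (p ^ n) = a [^] (p ^ n) \<oplus> b [^] (p ^ n)"
proof (induction n)
  case (Suc n)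
  have "(a \<oplus> b) [^] (p ^ Suc n) = ((a \<oplus> b) [^] (p ^ n)) [^] p"
    using a b by (simp add: nat_pow_pow mult.commute)
  also have "\<dots> = (a [^] (p ^ n)) [^] p \<oplus> (b [^] (p ^ n)) [^] p"
    unfolding Suc.IH using a b by (intro frobenius_add[OF p ch]) auto
  finally show ?case using a b by (simp add: nat_pow_pow mult.commute)
qed (use a b in simp)

lemma (in cring) frobenius_minus_power:
  fixes p :: nat
  assumes p: "Factorial_Ring.prime p" and ch: "add_pow R p \<one> = \<zero>"
    and a: "a \<in> carrier R" and b: "b \<in> carrier R"
  shows "(a \<ominus> b) [^] (p ^ n) = a [^] (p ^ n) \<ominus> b [^] (p ^ n)"
proof -
  have "a [^] (p ^ n) = ((a \<ominus> b) \<oplus> b) [^] (p ^ n)"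
    using a b by (simp add: minus_eq a_assoc l_neg)
  also have "\<dots> = (a \<ominus> b) [^] (p ^ n) \<oplus> b [^] (p ^ n)"
    using a b by (intro frobenius_add_power[OF p ch]) auto
  finally show ?thesis using a b by (simp add: minus_eq a_assoc r_neg)
qed

text \<open>
The nilradical, described through exponents \<open>p ^ k\<close> only: \<open>(x \<oplus> y) ^ (p ^ k)\<close> is
\<open>x ^ (p ^ k) \<oplus> y ^ (p ^ k)\<close>, so closure under sums needs no estimate of binomial terms. It
serves to show that an ideal generated by nilpotent elements is proper.
\<close>
lemma (in cring) char_p_nilpotents_ideal:
  fixes p :: nat
  assumes p: "Factorial_Ring.prime p" and ch: "add_pow R p \<one> = \<zero>"
  shows "ideal {x \<in> carrier R. \<exists>k. x [^] (p ^ k) = \<zero>} R" (is "ideal ?N R")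
proof (rule idealI)
  show "ring R" by (rule ring_axioms)
  show "subgroup ?N (add_monoid R)"
  proof (rule add.subgroupI)
    have "\<zero> [^] (p ^ 0) = \<zero>" by simp
    then show "?N \<noteq> {}" by blast
  next
    fix x assume "x \<in> ?N"
    then obtain k where x: "x \<in> carrier R" "x [^] (p ^ k) = \<zero>" by blast
    have "(\<zero> \<ominus> x) [^] (p ^ k) = \<zero> [^] (p ^ k) \<ominus> x [^] (p ^ k)"
      using x by (intro frobenius_minus_power[OF p ch]) auto
    also have "\<dots> = \<zero>" using x p by (simp add: minus_eq nat_pow_zero prime_gt_0_nat)
    finally show "\<ominus> x \<in> ?N" using x(1) by (auto simp: minus_eq)
  next
    fix x y assume "x \<in> ?N" "y \<in> ?N"
    then obtain k l where x: "x \<in> carrier R" "x [^] (p ^ k) = \<zero>"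
      and y: "y \<in> carrier R" "y [^] (p ^ l) = \<zero>" by blast
    have "x [^] (p ^ (k + l)) = (x [^] (p ^ k)) [^] (p ^ l)"
      using x(1) by (simp add: nat_pow_pow power_add)
    moreover have "y [^] (p ^ (k + l)) = (y [^] (p ^ l)) [^] (p ^ k)"
      using y(1) by (simp add: nat_pow_pow power_add mult.commute)
    ultimately have "(x \<oplus> y) [^] (p ^ (k + l)) = \<zero>"
      using x y p by (simp add: frobenius_add_power[OF p ch] nat_pow_zero prime_gt_0_nat)
    then show "x \<oplus> y \<in> ?N" using x y by blast
  qed auto
  fix a x assume "a \<in> ?N" and x: "x \<in> carrier R"
  then obtain k where a: "a \<in> carrier R" "a [^] (p ^ k) = \<zero>" by blast
  then have "(x \<otimes> a) [^] (p ^ k) = \<zero>" using x by (simp add: nat_pow_distrib)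
  then show "x \<otimes> a \<in> ?N" using a x by blast
  then show "a \<otimes> x \<in> ?N" using a x by (simp add: m_comm)
qed

section \<open>Maximal ideals generated by nilpotents\<close>

lemma (in primeideal) power_mem_imp_mem:
  assumes "x \<in> carrier R" and "x [^] (n::nat) \<in> I"
  shows "x \<in> I"
  using assms(2)
proof (induction n)
  case 0
  then have "\<one> \<in> I" by simp
  then show ?case using I_notcarr one_imp_carrier by blast
next
  case (Suc n)
  then have "x [^] n \<otimes> x \<in> I" by simp
  then have "x [^] n \<in> I \<or> x \<in> I" by (intro I_prime) (use assms(1) in auto)
  then show ?case using Suc.IH by blast
qed

text \<open>
A maximal ideal is prime, so it contains every nilpotent element, hence all of \<open>Idl S\<close>; by
maximality of \<open>Idl S\<close> the two agree.
\<close>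
lemma (in cring) nilpotent_generated_maximal_unique:
  assumes S: "S \<subseteq> carrier R" and nil: "\<And>x. x \<in> S \<Longrightarrow> \<exists>n::nat. x [^] n = \<zero>"
    and max: "maximalideal (Idl S) R"
  shows "{M. maximalideal M R} = {Idl S}"
proof -
  have "M = Idl S" if M: "maximalideal M R" for M
  proof -
    interpret M: maximalideal M R by (rule M)
    interpret P: primeideal M R by (rule maximalideal_prime[OF M])
    have "S \<subseteq> M"
    proof
      fix x assume "x \<in> S"
      then obtain n :: nat where "x [^] n = \<zero>" using nil by blast
      then show "x \<in> M" using P.power_mem_imp_mem[of x n] \<open>x \<in> S\<close> S by auto
    qed
    then have "Idl S \<subseteq> M" by (rule genideal_minimal[OF M.is_ideal])
    then show ?thesis
      using maximalideal.I_maximal[OF max M.is_ideal] M.a_subset M.I_notcarr by auto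
  qed
  then show ?thesis using max by blast
qed

text \<open>
The principal ideals of \<open>u\<close> and \<open>v\<close> are incomparable: if \<open>u = a \<otimes> v\<close> then
\<open>u \<otimes> v = a \<otimes> v\<^sup>2 = \<zero>\<close>, and symmetrically.
\<close>
lemma (in cring) not_chain_ring_if_square_zero:
  assumes u: "u \<in> carrier R" and v: "v \<in> carrier R"
    and uu: "u \<otimes> u = \<zero>" and vv: "v \<otimes> v = \<zero>" and uv: "u \<otimes> v \<noteq> \<zero>"
  shows "\<not> chain_ring R"
proof -
  have *: "\<not> PIdl x \<subseteq> PIdl y"
    if xy: "x \<in> carrier R" "y \<in> carrier R" "y \<otimes> y = \<zero>" "x \<otimes> y \<noteq> \<zero>" for x y
  proof
    assume "PIdl x \<subseteq> PIdl y"
    then obtain a where a: "a \<in> carrier R" "x = a \<otimes> y"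
      using cgenideal_self[OF xy(1)] unfolding cgenideal_def by blast
    have "x \<otimes> y = a \<otimes> (y \<otimes> y)" using a xy by (simp add: m_assoc)
    then show False using a xy by simp
  qed
  show ?thesis
  proof
    assume "chain_ring R"
    then have "PIdl u \<subseteq> PIdl v \<or> PIdl v \<subseteq> PIdl u"
      using cgenideal_ideal[OF u] cgenideal_ideal[OF v] unfolding chain_ring_def by blast
    then show False using *[OF u v vv uv] *[OF v u uu] uv m_comm[OF u v] by auto
  qed
qed

text \<open>
The elements of \<open>S\<close> congruent modulo \<open>I\<close> to some element of the image of \<open>h\<close> are closed under
products and sums.
\<close>
lemma (in ring_hom_ring) image_modulo_mult:
  assumes I: "ideal I S" and x: "x \<in> carrier R" "x' \<in> carrier R"
    and y: "y \<in> carrier S" "y' \<in> carrier S"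
    and mem: "y \<ominus>\<^bsub>S\<^esub> h x \<in> I" "y' \<ominus>\<^bsub>S\<^esub> h x' \<in> I"
  shows "y \<otimes>\<^bsub>S\<^esub> y' \<ominus>\<^bsub>S\<^esub> h (x \<otimes> x') \<in> I"
proof -
  interpret I: ideal I S by (rule I)
  have "y \<otimes>\<^bsub>S\<^esub> y' \<ominus>\<^bsub>S\<^esub> h (x \<otimes> x') =
      (y \<ominus>\<^bsub>S\<^esub> h x) \<otimes>\<^bsub>S\<^esub> y' \<oplus>\<^bsub>S\<^esub> h x \<otimes>\<^bsub>S\<^esub> (y' \<ominus>\<^bsub>S\<^esub> h x')"
    using x y
    by (simp add: S.minus_eq S.l_distr S.r_distr S.l_minus S.r_minus S.a_assoc S.r_neg1 S.r_neg2)
  then show ?thesis using mem x y by (simp add: I.I_l_closed I.I_r_closed I.a_closed)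
qed

lemma (in ring_hom_ring) image_modulo_add:
  assumes I: "ideal I S" and x: "x \<in> carrier R" "x' \<in> carrier R"
    and y: "y \<in> carrier S" "y' \<in> carrier S"
    and mem: "y \<ominus>\<^bsub>S\<^esub> h x \<in> I" "y' \<ominus>\<^bsub>S\<^esub> h x' \<in> I"
  shows "(y \<oplus>\<^bsub>S\<^esub> y') \<ominus>\<^bsub>S\<^esub> h (x \<oplus> x') \<in> I"
proof -
  interpret I: ideal I S by (rule I)
  have "(y \<oplus>\<^bsub>S\<^esub> y') \<ominus>\<^bsub>S\<^esub> h (x \<oplus> x') = (y \<ominus>\<^bsub>S\<^esub> h x) \<oplus>\<^bsub>S\<^esub> (y' \<ominus>\<^bsub>S\<^esub> h x')"
    using x y by (simp add: S.minus_eq S.minus_add S.a_ac)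
  then show ?thesis using mem by (simp add: I.a_closed)
qed

lemma (in ring_hom_ring) hom_add_pow:
  "x \<in> carrier R \<Longrightarrow> h (add_pow R (n::nat) x) = add_pow S n (h x)"
  by (induction n) simp_all

text \<open>
The map \<open>R \<rightarrow> S / I\<close> is onto and kills \<open>M\<close>, so \<open>S / I\<close> is a nonzero quotient of the
simple ring \<open>R / M\<close>. The proof argues with ideals directly: the preimage of an ideal \<open>J \<supseteq> I\<close>
contains \<open>M\<close>, so it is \<open>M\<close> or everything, and surjectivity modulo \<open>I\<close> carries this back to \<open>J\<close>.
\<close>
lemma (in ring_hom_ring) maximalideal_image_modulo:
  assumes M: "maximalideal M R" and I: "ideal I S" and proper: "I \<noteq> carrier S"
    and MI: "h ` M \<subseteq> I"
    and onto: "\<And>y. y \<in> carrier S \<Longrightarrow> \<exists>x\<in>carrier R. y \<ominus>\<^bsub>S\<^esub> h x \<in> I"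
  shows "maximalideal I S"
proof (rule maximalidealI[OF I])
  show "carrier S \<noteq> I" using proper by simp
  fix J assume J: "ideal J S" and IJ: "I \<subseteq> J" and JS: "J \<subseteq> carrier S"
  interpret M: maximalideal M R by (rule M)
  interpret I: ideal I S by (rule I)
  interpret J: ideal J S by (rule J)
  let ?V = "{r \<in> carrier R. h r \<in> J}"
  have V: "ideal ?V R" by (rule ideal_vimage[OF J])
  have "M \<subseteq> ?V" using MI IJ M.a_subset by auto
  then consider "?V = M" | "?V = carrier R" using M.I_maximal[OF V] by auto
  then show "J = I \<or> J = carrier S"
  proof cases
    case 1
    have "J \<subseteq> I"
    proof
      fix y assume y: "y \<in> J"
      obtain x where x: "x \<in> carrier R" "y \<ominus>\<^bsub>S\<^esub> h x \<in> I" using onto JS y by blast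
      have yS: "y \<in> carrier S" using y JS by auto
      have "h x = y \<ominus>\<^bsub>S\<^esub> (y \<ominus>\<^bsub>S\<^esub> h x)"
        using yS x by (simp add: S.minus_eq S.minus_add S.a_assoc[symmetric] S.r_neg)
      then have "h x \<in> J" using y x IJ
        by (metis J.a_closed J.a_inv_closed S.minus_eq subsetD)
      then have hx: "h x \<in> I" using 1 x MI by blast
      have "y = (y \<ominus>\<^bsub>S\<^esub> h x) \<oplus>\<^bsub>S\<^esub> h x" using yS x by (simp add: S.minus_eq S.a_assoc S.l_neg)
      then show "y \<in> I" using x hx by (metis I.a_closed)
    qed
    then show ?thesis using IJ by auto
  next
    case 2
    then have "\<one>\<^bsub>S\<^esub> \<in> J" using R.one_closed hom_one by (metis (mono_tags, lifting) mem_Collect_eq)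
    then show ?thesis using J.one_imp_carrier by auto
  qed
qed

section \<open>Finite fields\<close>

lemma (in domain) power_eq_zero_imp_zero:
  assumes "a \<in> carrier R" and "a [^] (n::nat) = \<zero>"
  shows "a = \<zero>"
  using assms(2)
proof (induction n)
  case (Suc n)
  then show ?case using assms(1) integral[of "a [^] n" a] by auto
qed simp

text \<open>
The additive group has order \<open>p ^ m\<close>, so \<open>p ^ m\<close> copies of \<open>\<one>\<close> add up to zero; that sum is the
\<open>m\<close>-th power of the sum of \<open>p\<close> copies, and a field has no nilpotents.
\<close>
lemma (in field) char_of_card:
  fixes p m :: nat
  assumes p: "Factorial_Ring.prime p" and card: "card (carrier R) = p ^ m"
  shows "add_pow R p \<one> = \<zero>"
proof -
  have pow: "add_pow R (p ^ k) \<one> = add_pow R p \<one> [^] k" for k :: nat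
  proof (induction k)
    case (Suc k)
    have "add_pow R (p ^ Suc k) \<one> = add_pow R p (add_pow R (p ^ k) \<one>)"
      by (simp add: add.nat_pow_pow mult.commute)
    also have "\<dots> = add_pow R p (\<one> \<otimes> add_pow R (p ^ k) \<one>)" by simp
    also have "\<dots> = add_pow R p \<one> \<otimes> add_pow R (p ^ k) \<one>"
      by (rule add_pow_ldistr [symmetric]) auto
    finally show ?case using Suc.IH by (simp add: m_comm)
  qed simp
  have "add_pow R (order (add_monoid R)) \<one> = \<zero>"
    by (rule add.pow_order_eq_1) simp
  then have "add_pow R p \<one> [^] m = \<zero>" using card pow by (simp add: order_def)
  then show ?thesis using power_eq_zero_imp_zero[of "add_pow R p \<one>" m] by simp
qed

lemma (in field) pow_card_carrier:
  assumes fin: "finite (carrier R)" and a: "a \<in> carrier R"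
  shows "a [^] card (carrier R) = a"
proof (cases "a = \<zero>")
  case True
  have "0 < card (carrier R)" using fin by (auto simp: card_gt_0_iff)
  then show ?thesis using True by (simp add: nat_pow_zero)
next
  case False
  interpret M: group "Multiplicative_Group.mult_of R" by (rule field_mult_group)
  have "a [^]\<^bsub>Multiplicative_Group.mult_of R\<^esub> order (Multiplicative_Group.mult_of R) = \<one>\<^bsub>Multiplicative_Group.mult_of R\<^esub>"
    using a False by (intro M.pow_order_eq_1) simp
  then have *: "a [^] (card (carrier R) - 1) = \<one>"
    using fin by (simp add: Multiplicative_Group.nat_pow_mult_of order_mult_of order_def)
  have "0 < card (carrier R)" using fin by (auto simp: card_gt_0_iff)
  then have "card (carrier R) = Suc (card (carrier R) - 1)" by simp
  then have "a [^] card (carrier R) = a [^] (card (carrier R) - 1) \<otimes> a"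
    by (metis nat_pow_Suc)
  then show ?thesis using * a by simp
qed

lemma (in field) pow_card_power:
  assumes fin: "finite (carrier R)" and a: "a \<in> carrier R"
  shows "a [^] (card (carrier R) ^ k) = a"
proof (induction k)
  case (Suc k)
  have "a [^] (card (carrier R) ^ Suc k) = (a [^] (card (carrier R) ^ k)) [^] card (carrier R)"
    using a by (simp add: nat_pow_pow mult.commute)
  then show ?case using Suc.IH pow_card_carrier[OF fin a] by simp
qed (use a in simp)

lemma (in cring) coprime_multiples_of_one_zero:
  fixes p q :: nat
  assumes "coprime p q" and p: "add_pow R p \<one> = \<zero>" and q: "add_pow R q \<one> = \<zero>"
  shows "\<one> = \<zero>"
proof -
  obtain x y where xy: "p * x - q * y = 1 \<or> q * x - p * y = 1"
    using bezout1_nat[of p q] assms(1) by (metis coprime_common_divisor_nat)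
  have z: "add_pow R (p * k) \<one> = \<zero>" "add_pow R (q * k) \<one> = \<zero>" for k
    using char_p_multiple_eq_zero[OF p, of "p * k" \<one>] char_p_multiple_eq_zero[OF q, of "q * k" \<one>] by auto
  from xy have "p * x = q * y + 1 \<or> q * x = p * y + 1" by linarith
  then show ?thesis
  proof
    assume "p * x = q * y + 1"
    then have "add_pow R (p * x) \<one> = add_pow R (q * y) \<one> \<oplus> \<one>" by simp
    then show ?thesis by (simp add: z)
  next
    assume "q * x = p * y + 1"
    then have "add_pow R (q * x) \<one> = add_pow R (p * y) \<one> \<oplus> \<one>" by simp
    then show ?thesis by (simp add: z)
  qed
qed

section \<open>Binomial polynomials and cubics\<close>

context UP_cring
begin

lemma binomial_poly_closed [simp]:
  "c \<in> carrier R \<Longrightarrow> binomial_poly R n c \<in> carrier P"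
  unfolding binomial_poly_def P_def[symmetric] by simp

lemma coeff_binomial_poly:
  assumes "c \<in> carrier R" and "0 < n"
  shows "up_ring.coeff P (binomial_poly R n c) k = (if k = n then \<one> else if k = 0 then \<ominus> c else \<zero>)"
  using assms unfolding binomial_poly_def P_def[symmetric] 
  by (auto simp: coeff_minus minus_eq)

text \<open>
A nonzero constant is not a multiple of the monic polynomial \<open>x\<^sup>n - c\<close>, even over a ring with zero
divisors. Comparing coefficients of degree \<open>k + n > 0\<close> gives \<open>g\<^sub>k = c \<otimes> g\<^sub>k\<^sub>+\<^sub>n\<close>, and for \<open>k\<close> the degree of
\<open>g\<close> this kills the leading coefficient.
\<close>
lemma binomial_poly_multiple_const:
  assumes c: "c \<in> carrier R" and d: "d \<in> carrier R" and n: "0 < n" and g: "g \<in> carrier P"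
    and eq: "g \<otimes>\<^bsub>P\<^esub> binomial_poly R n c = up_ring.monom P d 0"
  shows "d = \<zero>"
proof -
  have shift: "up_ring.coeff P g k = c \<otimes> up_ring.coeff P g (k + n)" for k
  proof -
    have "g \<otimes>\<^bsub>P\<^esub> binomial_poly R n c =
        up_ring.monom P \<one> n \<otimes>\<^bsub>P\<^esub> g \<ominus>\<^bsub>P\<^esub> c \<odot>\<^bsub>P\<^esub> g"
      using c g unfolding binomial_poly_def P_def[symmetric]
      by (simp add: monom_mult_is_smult[symmetric] P.minus_eq P.r_distr P.r_minus P.m_comm)
    then have "up_ring.coeff P (up_ring.monom P d 0) (k + n) = up_ring.coeff P g k \<ominus> c \<otimes> up_ring.coeff P g (k + n)"
      using c g coeff_monom_mult[of \<one> g n k] by (simp add: eq coeff_minus add.commute del: coeff_mult)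
    then have "up_ring.coeff P g k \<ominus> c \<otimes> up_ring.coeff P g (k + n) = \<zero>" using d n by simp
    then show ?thesis using c g by (simp add: R.r_right_minus_eq)
  qed
  have "up_ring.coeff P g (deg R g) = \<zero>"
    using shift[of "deg R g"] n g c by (simp add: deg_aboveD)
  then have "g = \<zero>\<^bsub>P\<^esub>" using lcoeff_nonzero2[OF g] by blast
  then have "up_ring.monom P d 0 = up_ring.monom P \<zero> 0" using eq c by simp
  then show ?thesis using monom_inj d by (auto simp: inj_on_def)
qed

lemma const_mem_binomial_ideal:
  assumes c: "c \<in> carrier R" and d: "d \<in> carrier R" and n: "0 < n"
    and mem: "up_ring.monom P d 0 \<in> Idl\<^bsub>P\<^esub> {binomial_poly R n c}"
  shows "d = \<zero>"
proof -
  have "up_ring.monom P d 0 \<in> PIdl\<^bsub>P\<^esub> (binomial_poly R n c)"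
    using mem P.cgenideal_eq_genideal c by simp
  then obtain g where "g \<in> carrier P" "up_ring.monom P d 0 = g \<otimes>\<^bsub>P\<^esub> binomial_poly R n c"
    unfolding cgenideal_def by blast
  then show ?thesis using binomial_poly_multiple_const[OF c d n] by metis
qed

end

lemma (in UP_domain) linear_poly_root:
  assumes F: "field R" and d: "d \<in> carrier P" and deg: "deg R d = 1"
  shows "\<exists>s\<in>carrier R. UnivPoly.eval R R id s d = \<zero>"
proof -
  interpret F: field R by (rule F)
  interpret UP_pre_univ_prop R R id P by standard simp
  define a b where "a = up_ring.coeff P d 0" and "b = up_ring.coeff P d 1"
  have ab: "a \<in> carrier R" "b \<in> carrier R" using d by (simp_all add: a_def b_def)
  have "b \<noteq> \<zero>" using lcoeff_nonzero_deg[of d] deg d by (simp add: b_def)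
  then have bU: "b \<in> Units R" using ab F.field_Units by blast
  then have ib: "inv b \<in> carrier R" by simp
  have d_eq: "d = up_ring.monom P b 1 \<oplus>\<^bsub>P\<^esub> up_ring.monom P a 0"
  proof (rule up_eqI)
    fix n :: nat
    consider "n = 0" | "n = 1" | "n > 1" by linarith
    then show "up_ring.coeff P d n = up_ring.coeff P (up_ring.monom P b 1 \<oplus>\<^bsub>P\<^esub> up_ring.monom P a 0) n"
      by cases (use d ab deg in \<open>auto simp: a_def b_def deg_aboveD\<close>)
  qed (use d ab in auto)
  define s where "s = inv b \<otimes> \<ominus> a"
  have s: "s \<in> carrier R" using ab ib by (simp add: s_def)
  interpret E: ring_hom_cring P R "UnivPoly.eval R R id s"
    by (rule ring_hom_cringI) (use s in \<open>auto intro: eval_ring_hom P.is_cring R.is_cring\<close>)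
  have "UnivPoly.eval R R id s d = b \<otimes> s \<oplus> a"
    using ab s eval_monom[of b s 1] eval_const[of s a] by (simp add: d_eq)
  also have "b \<otimes> s = \<ominus> a"
    using ab ib bU by (simp add: s_def R.m_assoc[symmetric] R.Units_r_inv)
  finally have "UnivPoly.eval R R id s d = \<zero>" using ab by (simp only: R.l_neg)
  with s show ?thesis by blast
qed

text \<open>
Pseudo-division multiplies \<open>f\<close> by a power of the leading coefficient of \<open>g\<close>, which is invertible over a
field.
\<close>
lemma (in UP_domain) poly_long_div:
  assumes F: "field R" and g: "g \<in> carrier P" "g \<noteq> \<zero>\<^bsub>P\<^esub>" and f: "f \<in> carrier P"
  obtains q r where "q \<in> carrier P" "r \<in> carrier P" "f = g \<otimes>\<^bsub>P\<^esub> q \<oplus>\<^bsub>P\<^esub> r"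
    "r = \<zero>\<^bsub>P\<^esub> \<or> deg R r < deg R g"
proof -
  interpret F: field R by (rule F)
  obtain q r and k :: nat where qr: "q \<in> carrier P" "r \<in> carrier P"
    "up_ring.coeff P g (deg R g) [^] k \<odot>\<^bsub>P\<^esub> f = g \<otimes>\<^bsub>P\<^esub> q \<oplus>\<^bsub>P\<^esub> r" "r = \<zero>\<^bsub>P\<^esub> \<or> deg R r < deg R g"
    using long_div_theorem[OF g(1) f g(2)] by blast
  define l where "l = up_ring.coeff P g (deg R g) [^] k"
  have l: "l \<in> carrier R" "l \<noteq> \<zero>"
    using lcoeff_nonzero2[OF g] g R.power_eq_zero_imp_zero by (auto simp: l_def)
  then have lU: "l \<in> Units R" using F.field_Units by blast
  have il: "inv l \<in> carrier R" using lU by simp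
  have "f = inv l \<odot>\<^bsub>P\<^esub> (l \<odot>\<^bsub>P\<^esub> f)"
    using l il lU f by (simp add: UP_smult_assoc1[symmetric] R.Units_l_inv)
  also have "\<dots> = inv l \<odot>\<^bsub>P\<^esub> (g \<otimes>\<^bsub>P\<^esub> q) \<oplus>\<^bsub>P\<^esub> inv l \<odot>\<^bsub>P\<^esub> r"
    using qr g il by (simp add: l_def[symmetric] UP_smult_r_distr)
  also have "inv l \<odot>\<^bsub>P\<^esub> (g \<otimes>\<^bsub>P\<^esub> q) = g \<otimes>\<^bsub>P\<^esub> (inv l \<odot>\<^bsub>P\<^esub> q)"
    using qr g il by (simp add: UP_smult_assoc2[symmetric] P.m_comm[of g])
  finally have "f = g \<otimes>\<^bsub>P\<^esub> (inv l \<odot>\<^bsub>P\<^esub> q) \<oplus>\<^bsub>P\<^esub> inv l \<odot>\<^bsub>P\<^esub> r" .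
  moreover have "inv l \<odot>\<^bsub>P\<^esub> q \<in> carrier P" "inv l \<odot>\<^bsub>P\<^esub> r \<in> carrier P"
    using qr il by auto
  moreover have "inv l \<odot>\<^bsub>P\<^esub> r = \<zero>\<^bsub>P\<^esub> \<or> deg R (inv l \<odot>\<^bsub>P\<^esub> r) < deg R g"
    using qr il by (cases "r = \<zero>\<^bsub>P\<^esub>") auto
  ultimately show thesis using that by blast
qed

text \<open>
If \<open>c\<close> is not a cube then \<open>x\<^sup>3 - c\<close> has no root, and a polynomial of degree 3 without roots over a
field is irreducible. An ideal \<open>J\<close> above it is generated by a nonzero element \<open>d\<close> of least degree; \<open>d\<close> divides
\<open>x\<^sup>3 - c\<close>, and a linear divisor or cofactor would have a root, so \<open>d\<close> has degree 0 (and \<open>J\<close> is the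
whole ring) or degree 3 (and \<open>x\<^sup>3 - c\<close> itself generates \<open>J\<close>).
\<close>
lemma (in UP_domain) non_cube_maximal:
  assumes F: "field R" and c: "c \<in> carrier R" and nc: "\<not> is_cube R c"
  shows "maximalideal (Idl\<^bsub>P\<^esub> {binomial_poly R 3 c}) P"
proof (rule maximalidealI)
  interpret F: field R by (rule F)
  interpret UP_pre_univ_prop R R id P by standard simp
  let ?h = "binomial_poly R 3 c"
  have h: "?h \<in> carrier P" using c by simp
  have hc: "up_ring.coeff P ?h k = (if k = 3 then \<one> else if k = 0 then \<ominus> c else \<zero>)" for k
    using coeff_binomial_poly[of c 3 k] c by simp
  have hdeg: "deg R ?h = 3"
  proof (rule le_antisym)
    show "deg R ?h \<le> 3" using h by (intro deg_aboveI) (auto simp: hc)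
    show "3 \<le> deg R ?h" using h by (intro deg_belowI) (auto simp: hc)
  qed
  have h0: "?h \<noteq> \<zero>\<^bsub>P\<^esub>" using hdeg deg_zero by force
  have noroot: "UnivPoly.eval R R id s ?h \<noteq> \<zero>" if s: "s \<in> carrier R" for s
  proof
    interpret E: ring_hom_cring P R "UnivPoly.eval R R id s"
      by (rule ring_hom_cringI) (use s in \<open>auto intro: eval_ring_hom P.is_cring R.is_cring\<close>)
    assume "UnivPoly.eval R R id s ?h = \<zero>"
    moreover have "UnivPoly.eval R R id s ?h = s [^] (3::nat) \<ominus> c"
      unfolding binomial_poly_def P_def[symmetric]
      using c s eval_monom[of \<one> s 3] eval_const[of s c] by (simp add: P.minus_eq R.minus_eq)
    ultimately have "s [^] (3::nat) = c" using c s by simp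
    then show False using nc s by (auto simp: is_cube_def)
  qed
  have nofactor: "deg R d \<noteq> 1" if dq: "d \<in> carrier P" "q \<in> carrier P" "?h = d \<otimes>\<^bsub>P\<^esub> q" for d q
  proof
    assume "deg R d = 1"
    then obtain s where s: "s \<in> carrier R" "UnivPoly.eval R R id s d = \<zero>"
      using linear_poly_root[OF F dq(1)] by blast
    interpret E: ring_hom_cring P R "UnivPoly.eval R R id s"
      by (rule ring_hom_cringI) (use s in \<open>auto intro: eval_ring_hom P.is_cring R.is_cring\<close>)
    have "UnivPoly.eval R R id s ?h = \<zero>" using dq s by simp
    then show False using noroot s by blast
  qed
  show I: "ideal (Idl\<^bsub>P\<^esub> {?h}) P" using h by (intro P.genideal_ideal) auto
  show "carrier P \<noteq> Idl\<^bsub>P\<^esub> {?h}"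
  proof
    assume "carrier P = Idl\<^bsub>P\<^esub> {?h}"
    then have "up_ring.monom P \<one> 0 \<in> Idl\<^bsub>P\<^esub> {?h}" by auto
    then show False using const_mem_binomial_ideal[OF c R.one_closed, of 3] by simp
  qed
  fix J assume J: "ideal J P" and IJ: "Idl\<^bsub>P\<^esub> {?h} \<subseteq> J" and "J \<subseteq> carrier P"
  interpret J: ideal J P by (rule J)
  have hJ: "?h \<in> J" using IJ P.genideal_self'[OF h] by blast
  define d where "d = arg_min (deg R) (\<lambda>d. d \<in> J \<and> d \<noteq> \<zero>\<^bsub>P\<^esub>)"
  have dmem: "d \<in> J" "d \<noteq> \<zero>\<^bsub>P\<^esub>"
    using arg_min_natI[of "\<lambda>d. d \<in> J \<and> d \<noteq> \<zero>\<^bsub>P\<^esub>" ?h "deg R"] hJ h0 by (auto simp: d_def)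
  have dmin: "deg R d \<le> deg R f" if "f \<in> J" "f \<noteq> \<zero>\<^bsub>P\<^esub>" for f
    using arg_min_nat_le[of "\<lambda>d. d \<in> J \<and> d \<noteq> \<zero>\<^bsub>P\<^esub>" f "deg R"] that by (simp add: d_def)
  have dP: "d \<in> carrier P" using dmem J.a_subset by blast
  \<comment> \<open>Phrased for every nonzero element of least degree, so that it applies both to \<open>d\<close> and to \<open>x\<^sup>3 - c\<close>.\<close>
  have divides: "\<exists>q\<in>carrier P. f = g \<otimes>\<^bsub>P\<^esub> q"
    if f: "f \<in> J" and g: "g \<in> J" "g \<noteq> \<zero>\<^bsub>P\<^esub>" "deg R g = deg R d" for f g
  proof -
    have fP: "f \<in> carrier P" and gP: "g \<in> carrier P" using f g J.a_subset by auto
    obtain q r where qr: "q \<in> carrier P" "r \<in> carrier P" "f = g \<otimes>\<^bsub>P\<^esub> q \<oplus>\<^bsub>P\<^esub> r"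
      "r = \<zero>\<^bsub>P\<^esub> \<or> deg R r < deg R g"
      by (rule poly_long_div[OF F gP g(2) fP])
    have gq: "g \<otimes>\<^bsub>P\<^esub> q \<in> J" using J.I_r_closed g qr by blast
    have "r = f \<ominus>\<^bsub>P\<^esub> g \<otimes>\<^bsub>P\<^esub> q"
      using qr gP by (simp add: P.minus_eq P.a_ac P.r_neg)
    then have "r \<in> J" using f gq by (simp add: P.minus_eq)
    then have "r = \<zero>\<^bsub>P\<^esub>" using dmin[of r] qr(4) g(3) by (metis leD)
    then show ?thesis using qr gP by auto
  qed
  obtain q where q: "q \<in> carrier P" "?h = d \<otimes>\<^bsub>P\<^esub> q" using divides[OF hJ dmem] by auto
  have q0: "q \<noteq> \<zero>\<^bsub>P\<^esub>" using q h0 dP by auto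
  have "deg R d + deg R q = 3" using deg_mult[OF dmem(2) q0 dP q(1)] q(2) hdeg by simp
  moreover have "deg R d \<noteq> 1" using nofactor[OF dP q] .
  moreover have "deg R q \<noteq> 1" using nofactor[OF q(1) dP] q dP by (simp add: P.m_comm)
  ultimately consider "deg R d = 0" | "deg R d = 3" by linarith
  then show "J = Idl\<^bsub>P\<^esub> {?h} \<or> J = carrier P"
  proof cases
    case 1
    define a where "a = up_ring.coeff P d 0"
    have a: "a \<in> carrier R" using dP by (simp add: a_def)
    have d: "d = up_ring.monom P a 0" unfolding a_def by (rule deg_zero_impl_monom[OF dP 1])
    then have "a \<noteq> \<zero>" using dmem by auto
    then have aU: "a \<in> Units R" using a F.field_Units by blast
    have "up_ring.monom P (inv a) 0 \<otimes>\<^bsub>P\<^esub> d = \<one>\<^bsub>P\<^esub>"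
      using a aU unfolding d by (simp add: monom_mult[symmetric] R.Units_l_inv)
    then have "\<one>\<^bsub>P\<^esub> \<in> J" using J.I_l_closed[OF dmem(1), of "up_ring.monom P (inv a) 0"] aU by simp
    then show ?thesis using J.one_imp_carrier by blast
  next
    case 2
    have "J \<subseteq> Idl\<^bsub>P\<^esub> {?h}"
    proof
      fix f assume "f \<in> J"
      then obtain q where "q \<in> carrier P" "f = ?h \<otimes>\<^bsub>P\<^esub> q"
        using divides[of f ?h] hJ h0 hdeg 2 by auto
      then show "f \<in> Idl\<^bsub>P\<^esub> {?h}"
        using ideal.I_r_closed[OF I] P.genideal_self'[OF h] by blast
    qed
    then show ?thesis using IJ by auto
  qed
qed

section \<open>The ring F[u, v] with square-zero variables\<close>

lemma (in ideal) finsum_mem: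
  assumes "\<And>i. i \<in> A \<Longrightarrow> f i \<in> I"
  shows "finsum R f A \<in> I"
  using assms
proof (induction A rule: infinite_finite_induct)
  case (insert x A)
  then have "f \<in> A \<rightarrow> carrier R" "f x \<in> carrier R" using a_subset by auto
  then show ?case using insert by (simp add: finsum_insert a_closed)
qed (auto simp: zero_closed)

context UP_cring
begin

text \<open>
This is the preimage of \<open>0\<close> under reduction modulo \<open>I\<close> and truncation after degree \<open>n\<close>. Applied twice
with \<open>n = 1\<close> it yields an ideal of \<open>F[u, v]\<close> that bounds \<open>uv_ideal\<close> from above.
\<close>
lemma low_coeffs_ideal:
  assumes I: "ideal I R"
  shows "ideal {f \<in> carrier P. \<forall>i\<le>n. up_ring.coeff P f i \<in> I} P" (is "ideal ?K P")
proof (rule idealI)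
  interpret I: ideal I R by (rule I)
  show "ring P" by (rule P.ring_axioms)
  show "subgroup ?K (add_monoid P)"
  proof (rule P.add.subgroupI)
    show "?K \<noteq> {}" using I.zero_closed by (auto intro!: exI[of _ "\<zero>\<^bsub>P\<^esub>"])
  qed (auto simp: I.a_inv_closed I.a_closed)
  fix f x assume f: "f \<in> ?K" and x: "x \<in> carrier P"
  have "up_ring.coeff P (x \<otimes>\<^bsub>P\<^esub> f) i \<in> I" if i: "i \<le> n" for i
  proof -
    have "(\<Oplus>k\<in>{..i}. up_ring.coeff P x k \<otimes> up_ring.coeff P f (i - k)) \<in> I"
      by (rule I.finsum_mem) (use f x i in \<open>auto intro!: I.I_l_closed\<close>)
    then show ?thesis using f x by simp
  qed
  then show "x \<otimes>\<^bsub>P\<^esub> f \<in> ?K" using f x by auto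
  then show "f \<otimes>\<^bsub>P\<^esub> x \<in> ?K" using f x by (simp add: P.m_comm)
qed

lemma split_constant_term:
  assumes f: "f \<in> carrier P" and nontriv: "\<one> \<noteq> \<zero>"
  shows "\<exists>q\<in>carrier P. \<exists>c\<in>carrier R. f = up_ring.monom P \<one> 1 \<otimes>\<^bsub>P\<^esub> q \<oplus>\<^bsub>P\<^esub> up_ring.monom P c 0"
proof -
  obtain q r where qr: "q \<in> carrier P" "r \<in> carrier P" "deg R r = 0"
    "f = (up_ring.monom P \<one> 1 \<ominus>\<^bsub>P\<^esub> up_ring.monom P \<zero> 0) \<otimes>\<^bsub>P\<^esub> q \<oplus>\<^bsub>P\<^esub> r"
    using remainder_theorem_exist[OF f R.zero_closed] nontriv by auto
  then have "f = up_ring.monom P \<one> 1 \<otimes>\<^bsub>P\<^esub> q \<oplus>\<^bsub>P\<^esub> up_ring.monom P (up_ring.coeff P r 0) 0"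
    using deg_zero_impl_monom[OF qr(2,3)] by (simp add: P.minus_eq)
  then show ?thesis using qr(1) coeff_closed[OF qr(2)] by blast
qed

end

context cring
begin

lemma Fuv_UP_cring: "UP_cring R" "UP_cring (UP R)"
  by (auto intro!: UP_cring.intro is_cring UP_cring.UP_cring)

lemma Fuv_cring: "cring (Fuv R)"
  using Fuv_UP_cring(2) by (rule UP_cring.UP_cring)

lemma Fuv_closed:
  "Fuv_u R \<in> carrier (Fuv R)" "Fuv_v R \<in> carrier (Fuv R)"
proof -
  interpret I: UP_cring R "UP R" by (rule Fuv_UP_cring) simp
  interpret O: UP_cring "UP R" "Fuv R" by (rule Fuv_UP_cring) simp
  show "Fuv_u R \<in> carrier (Fuv R)" "Fuv_v R \<in> carrier (Fuv R)"
    by (simp_all add: Fuv_u_def Fuv_v_def)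
qed

lemma Fuv_const_hom: "Fuv_const R \<in> ring_hom R (Fuv R)"
proof -
  interpret I: UP_cring R "UP R" by (rule Fuv_UP_cring) simp
  interpret O: UP_cring "UP R" "Fuv R" by (rule Fuv_UP_cring) simp
  show ?thesis
    using ring_hom_trans[OF I.const_ring_hom O.const_ring_hom]
    unfolding Fuv_const_def comp_def by simp
qed

lemma uv_ideal_ideal: "ideal (uv_ideal R) (Fuv R)"
proof -
  interpret S: cring "Fuv R" by (rule Fuv_cring)
  show ?thesis unfolding uv_ideal_def
    by (rule S.genideal_ideal) (use Fuv_closed in auto)
qed

text \<open>
The ideal \<open>\<langle>u\<^sup>2, v\<^sup>2\<rangle>\<close> contains no polynomial with a nonzero coefficient at \<open>1\<close>, \<open>u\<close>, \<open>v\<close> or \<open>uv\<close>; this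
is what makes \<open>uv\<close> nonzero in the quotient.
\<close>
lemma uv_ideal_low_coeffs:
  assumes "f \<in> uv_ideal R" and "i \<le> 1" and "j \<le> 1"
  shows "up_ring.coeff (UP R) (up_ring.coeff (Fuv R) f i) j = \<zero>"
proof -
  interpret I: UP_cring R "UP R" by (rule Fuv_UP_cring) simp
  interpret O: UP_cring "UP R" "Fuv R" by (rule Fuv_UP_cring) simp
  define K1 where "K1 = {g \<in> carrier (UP R). \<forall>j\<le>1. up_ring.coeff (UP R) g j \<in> {\<zero>}}"
  define K where "K = {f \<in> carrier (Fuv R). \<forall>i\<le>1. up_ring.coeff (Fuv R) f i \<in> K1}"
  have K1: "ideal K1 (UP R)" unfolding K1_def by (rule I.low_coeffs_ideal[OF zeroideal])
  have K: "ideal K (Fuv R)" unfolding K_def by (rule O.low_coeffs_ideal[OF K1])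
  have z: "\<zero>\<^bsub>UP R\<^esub> \<in> K1" by (simp add: K1_def)
  have "Fuv_u R [^]\<^bsub>Fuv R\<^esub> (2::nat) = up_ring.monom (Fuv R) (up_ring.monom (UP R) \<one> 2) 0"
    by (simp add: Fuv_u_def O.monom_pow I.monom_pow)
  moreover have "up_ring.monom (UP R) \<one> 2 \<in> K1" by (auto simp: K1_def)
  ultimately have 1: "Fuv_u R [^]\<^bsub>Fuv R\<^esub> (2::nat) \<in> K" using z by (auto simp: K_def)
  have "Fuv_v R [^]\<^bsub>Fuv R\<^esub> (2::nat) = up_ring.monom (Fuv R) \<one>\<^bsub>UP R\<^esub> 2"
    by (simp add: Fuv_v_def O.monom_pow)
  then have 2: "Fuv_v R [^]\<^bsub>Fuv R\<^esub> (2::nat) \<in> K" using z by (auto simp: K_def)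
  have "Fuv_u R \<otimes>\<^bsub>Fuv R\<^esub> Fuv_v R \<ominus>\<^bsub>Fuv R\<^esub> Fuv_v R \<otimes>\<^bsub>Fuv R\<^esub> Fuv_u R = \<zero>\<^bsub>Fuv R\<^esub>"
    using Fuv_closed by (simp add: O.P.m_comm[of "Fuv_u R"] O.P.minus_eq O.P.r_neg)
  then have 3: "Fuv_u R \<otimes>\<^bsub>Fuv R\<^esub> Fuv_v R \<ominus>\<^bsub>Fuv R\<^esub> Fuv_v R \<otimes>\<^bsub>Fuv R\<^esub> Fuv_u R \<in> K"
    using K by (simp add: additive_subgroup.zero_closed ideal.axioms(1))
  have "uv_ideal R \<subseteq> K"
    unfolding uv_ideal_def using 1 2 3 by (intro O.P.genideal_minimal[OF K]) auto
  then show ?thesis using assms by (auto simp: K_def K1_def)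
qed

lemma Ruv_cring: "cring (Ruv R)"
  unfolding Ruv_def by (rule ideal.quotient_is_cring[OF uv_ideal_ideal Fuv_cring])

lemma Ruv_proj_hom: "(\<lambda>f. uv_ideal R +>\<^bsub>Fuv R\<^esub> f) \<in> ring_hom (Fuv R) (Ruv R)"
  unfolding Ruv_def by (rule ideal.rcos_ring_hom[OF uv_ideal_ideal])

lemma Ruv_const_hom: "Ruv_const R \<in> ring_hom R (Ruv R)"
  using ring_hom_trans[OF Fuv_const_hom Ruv_proj_hom]
  unfolding Ruv_const_def comp_def by simp

lemma Ruv_closed: "Ruv_u R \<in> carrier (Ruv R)" "Ruv_v R \<in> carrier (Ruv R)"
  unfolding Ruv_u_def Ruv_v_def using ring_hom_closed[OF Ruv_proj_hom] Fuv_closed by auto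

lemma Ruv_proj_eq_zero_iff:
  assumes "f \<in> carrier (Fuv R)"
  shows "uv_ideal R +>\<^bsub>Fuv R\<^esub> f = \<zero>\<^bsub>Ruv R\<^esub> \<longleftrightarrow> f \<in> uv_ideal R"
proof -
  interpret S: cring "Fuv R" by (rule Fuv_cring)
  have "\<zero>\<^bsub>Ruv R\<^esub> = uv_ideal R" by (simp add: Ruv_def FactRing_def)
  then show ?thesis
    using ideal.rcos_const_imp_mem[OF uv_ideal_ideal assms] S.a_rcos_zero[OF uv_ideal_ideal] by auto
qed

lemma Ruv_squares:
  "Ruv_u R \<otimes>\<^bsub>Ruv R\<^esub> Ruv_u R = \<zero>\<^bsub>Ruv R\<^esub>" "Ruv_v R \<otimes>\<^bsub>Ruv R\<^esub> Ruv_v R = \<zero>\<^bsub>Ruv R\<^esub>"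
proof -
  interpret S: cring "Fuv R" by (rule Fuv_cring)
  have gen: "Fuv_u R [^]\<^bsub>Fuv R\<^esub> (2::nat) \<in> uv_ideal R" "Fuv_v R [^]\<^bsub>Fuv R\<^esub> (2::nat) \<in> uv_ideal R"
    using S.genideal_self[of "{Fuv_u R [^]\<^bsub>Fuv R\<^esub> (2::nat), Fuv_v R [^]\<^bsub>Fuv R\<^esub> (2::nat),
      Fuv_u R \<otimes>\<^bsub>Fuv R\<^esub> Fuv_v R \<ominus>\<^bsub>Fuv R\<^esub> Fuv_v R \<otimes>\<^bsub>Fuv R\<^esub> Fuv_u R}"] Fuv_closed
    unfolding uv_ideal_def by auto
  have sq: "x [^]\<^bsub>Fuv R\<^esub> (2::nat) = x \<otimes>\<^bsub>Fuv R\<^esub> x" if "x \<in> carrier (Fuv R)" for x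
    using that by (simp add: numeral_2_eq_2)
  show "Ruv_u R \<otimes>\<^bsub>Ruv R\<^esub> Ruv_u R = \<zero>\<^bsub>Ruv R\<^esub>" "Ruv_v R \<otimes>\<^bsub>Ruv R\<^esub> Ruv_v R = \<zero>\<^bsub>Ruv R\<^esub>"
    unfolding Ruv_u_def Ruv_v_def
    using gen Fuv_closed ring_hom_mult[OF Ruv_proj_hom, symmetric]
    by (simp_all add: Ruv_proj_eq_zero_iff sq)
qed

lemma Ruv_uv_nonzero:
  assumes "\<one> \<noteq> \<zero>"
  shows "Ruv_u R \<otimes>\<^bsub>Ruv R\<^esub> Ruv_v R \<noteq> \<zero>\<^bsub>Ruv R\<^esub>"
proof
  interpret I: UP_cring R "UP R" by (rule Fuv_UP_cring) simp
  interpret O: UP_cring "UP R" "Fuv R" by (rule Fuv_UP_cring) simp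
  assume "Ruv_u R \<otimes>\<^bsub>Ruv R\<^esub> Ruv_v R = \<zero>\<^bsub>Ruv R\<^esub>"
  then have mem: "Fuv_u R \<otimes>\<^bsub>Fuv R\<^esub> Fuv_v R \<in> uv_ideal R"
    unfolding Ruv_u_def Ruv_v_def
    using Fuv_closed ring_hom_mult[OF Ruv_proj_hom, symmetric] by (simp add: Ruv_proj_eq_zero_iff)
  have "Fuv_u R \<otimes>\<^bsub>Fuv R\<^esub> Fuv_v R = up_ring.monom (Fuv R) (up_ring.monom (UP R) \<one> 1) 1"
    unfolding Fuv_u_def Fuv_v_def by (subst O.monom_mult[symmetric]) auto
  then show False using uv_ideal_low_coeffs[OF mem, of 1 1] assms by simp
qed

text \<open>
Split off the constant term twice, first with respect to \<open>v\<close> and then with respect to \<open>u\<close>.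
\<close>
lemma Ruv_decomposition:
  assumes nontriv: "\<one> \<noteq> \<zero>" and x: "x \<in> carrier (Ruv R)"
  shows "\<exists>c\<in>carrier R. \<exists>a\<in>carrier (Ruv R). \<exists>b\<in>carrier (Ruv R).
    x = Ruv_const R c \<oplus>\<^bsub>Ruv R\<^esub> (Ruv_u R \<otimes>\<^bsub>Ruv R\<^esub> a \<oplus>\<^bsub>Ruv R\<^esub> Ruv_v R \<otimes>\<^bsub>Ruv R\<^esub> b)"
proof -
  interpret I: UP_cring R "UP R" by (rule Fuv_UP_cring) simp
  interpret O: UP_cring "UP R" "Fuv R" by (rule Fuv_UP_cring) simp
  interpret pr: ring_hom_cring "Fuv R" "Ruv R" "\<lambda>f. uv_ideal R +>\<^bsub>Fuv R\<^esub> f"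
    by (rule ring_hom_cringI[OF Fuv_cring Ruv_cring Ruv_proj_hom])
  have UPnontriv: "\<one>\<^bsub>UP R\<^esub> \<noteq> \<zero>\<^bsub>UP R\<^esub>"
  proof
    assume "\<one>\<^bsub>UP R\<^esub> = \<zero>\<^bsub>UP R\<^esub>"
    then have "up_ring.coeff (UP R) \<one>\<^bsub>UP R\<^esub> 0 = \<zero>" by simp
    then show False using nontriv by simp
  qed
  obtain f where f: "f \<in> carrier (Fuv R)" "x = uv_ideal R +>\<^bsub>Fuv R\<^esub> f"
    using x unfolding Ruv_def FactRing_def A_RCOSETS_def' by auto
  obtain q g where q: "q \<in> carrier (Fuv R)" and g: "g \<in> carrier (UP R)"
    and fq: "f = Fuv_v R \<otimes>\<^bsub>Fuv R\<^esub> q \<oplus>\<^bsub>Fuv R\<^esub> up_ring.monom (Fuv R) g 0"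
    using O.split_constant_term[OF f(1) UPnontriv] unfolding Fuv_v_def by blast
  obtain r c where r: "r \<in> carrier (UP R)" and c: "c \<in> carrier R"
    and gr: "g = up_ring.monom (UP R) \<one> 1 \<otimes>\<^bsub>UP R\<^esub> r \<oplus>\<^bsub>UP R\<^esub> up_ring.monom (UP R) c 0"
    using I.split_constant_term[OF g nontriv] by blast
  define r' where "r' = up_ring.monom (Fuv R) r 0"
  have r': "r' \<in> carrier (Fuv R)" using r by (simp add: r'_def)
  have cc: "Fuv_const R c \<in> carrier (Fuv R)" using c ring_hom_closed[OF Fuv_const_hom] by blast
  have "up_ring.monom (Fuv R) g 0 = Fuv_u R \<otimes>\<^bsub>Fuv R\<^esub> r' \<oplus>\<^bsub>Fuv R\<^esub> Fuv_const R c"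
    using r c unfolding gr r'_def Fuv_u_def Fuv_const_def
    by (subst O.monom_mult[symmetric]) auto
  then have "x = Ruv_v R \<otimes>\<^bsub>Ruv R\<^esub> (uv_ideal R +>\<^bsub>Fuv R\<^esub> q) \<oplus>\<^bsub>Ruv R\<^esub>
      (Ruv_u R \<otimes>\<^bsub>Ruv R\<^esub> (uv_ideal R +>\<^bsub>Fuv R\<^esub> r') \<oplus>\<^bsub>Ruv R\<^esub> Ruv_const R c)"
    using f fq q r' cc Fuv_closed by (simp add: Ruv_u_def Ruv_v_def Ruv_const_def)
  also have "\<dots> = Ruv_const R c \<oplus>\<^bsub>Ruv R\<^esub> (Ruv_u R \<otimes>\<^bsub>Ruv R\<^esub> (uv_ideal R +>\<^bsub>Fuv R\<^esub> r') \<oplus>\<^bsub>Ruv R\<^esub>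
      Ruv_v R \<otimes>\<^bsub>Ruv R\<^esub> (uv_ideal R +>\<^bsub>Fuv R\<^esub> q))"
    using q r' c Ruv_closed ring_hom_closed[OF Ruv_const_hom c] by (simp add: pr.S.a_ac)
  finally show ?thesis using c q r' pr.hom_closed by blast
qed

end

lemma (in cring) cube_of_square_zero_shift:
  assumes b: "b \<in> carrier R" and e: "e \<in> carrier R" and ee: "e \<otimes> e = \<zero>"
  shows "(b \<oplus> e) [^] (3::nat) = b [^] (3::nat) \<oplus> (b \<otimes> b \<otimes> e \<oplus> b \<otimes> b \<otimes> e \<oplus> b \<otimes> b \<otimes> e)"
proof -
  have cube: "x [^] (3::nat) = x \<otimes> x \<otimes> x" if "x \<in> carrier R" for x
    using that by (simp add: numeral_3_eq_3)
  have ee': "e \<otimes> (e \<otimes> x) = \<zero>" if "x \<in> carrier R" for x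
    using that e ee by (simp add: m_assoc[symmetric])
  show ?thesis
    using b e ee ee' by (simp add: cube l_distr r_distr m_ac a_ac)
qed

text \<open>
The cube root \<open>b\<close> of \<open>b\<^sup>3\<close> can be corrected to one of \<open>b\<^sup>3 + d uv\<close>: since \<open>(uv)\<^sup>2 = 0\<close>,
\<open>(b + t uv)\<^sup>3 = b\<^sup>3 + 3 b\<^sup>2 t uv\<close>, and \<open>3 b\<^sup>2\<close> is invertible.
\<close>
lemma (in field) elem_uv_is_cube:
  assumes b: "b \<in> carrier R" "b \<noteq> \<zero>" and d: "d \<in> carrier R"
    and three: "add_pow R (3::nat) \<one> \<noteq> \<zero>"
  shows "is_cube (Ruv R) (elem_uv R (b [^] (3::nat)) d)"
proof -
  interpret c: ring_hom_cring R "Ruv R" "Ruv_const R"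
    by (rule ring_hom_cringI[OF is_cring Ruv_cring Ruv_const_hom])
  define w where "w = add_pow R (3::nat) \<one> \<otimes> (b \<otimes> b)"
  have w: "w \<in> carrier R" using b by (simp add: w_def)
  have "w \<noteq> \<zero>" using b three integral[of "add_pow R (3::nat) \<one>" "b \<otimes> b"] integral[of b b]
    unfolding w_def by auto
  then have wU: "w \<in> Units R" using field_Units w by auto
  define t where "t = d \<otimes> inv w"
  have t: "t \<in> carrier R" using d wU by (simp add: t_def)
  have w_eq: "w = b \<otimes> b \<oplus> b \<otimes> b \<oplus> b \<otimes> b"
    using b by (simp add: w_def numeral_3_eq_3 l_distr)
  have "b \<otimes> b \<otimes> t \<oplus> b \<otimes> b \<otimes> t \<oplus> b \<otimes> b \<otimes> t = w \<otimes> t"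
    unfolding w_eq using b t by (simp add: l_distr)
  also have "\<dots> = d \<otimes> (w \<otimes> inv w)" using w wU d by (simp add: t_def m_ac)
  finally have bt: "b \<otimes> b \<otimes> t \<oplus> b \<otimes> b \<otimes> t \<oplus> b \<otimes> b \<otimes> t = d" using wU d by simp
  let ?B = "Ruv_const R b" and ?T = "Ruv_const R t"
  define y where "y = Ruv_u R \<otimes>\<^bsub>Ruv R\<^esub> Ruv_v R"
  have y: "y \<in> carrier (Ruv R)" using Ruv_closed by (simp add: y_def)
  have yy: "y \<otimes>\<^bsub>Ruv R\<^esub> y = \<zero>\<^bsub>Ruv R\<^esub>"
  proof -
    have "y \<otimes>\<^bsub>Ruv R\<^esub> y = (Ruv_u R \<otimes>\<^bsub>Ruv R\<^esub> Ruv_u R) \<otimes>\<^bsub>Ruv R\<^esub> (Ruv_v R \<otimes>\<^bsub>Ruv R\<^esub> Ruv_v R)"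
      unfolding y_def using Ruv_closed by (simp only: c.S.m_ac c.S.m_closed)
    then show ?thesis by (simp add: Ruv_squares)
  qed
  let ?e = "?T \<otimes>\<^bsub>Ruv R\<^esub> y"
  have e: "?e \<in> carrier (Ruv R)" using t y by simp
  have ee: "?e \<otimes>\<^bsub>Ruv R\<^esub> ?e = \<zero>\<^bsub>Ruv R\<^esub>"
  proof -
    have "?e \<otimes>\<^bsub>Ruv R\<^esub> ?e = (?T \<otimes>\<^bsub>Ruv R\<^esub> ?T) \<otimes>\<^bsub>Ruv R\<^esub> (y \<otimes>\<^bsub>Ruv R\<^esub> y)"
      using t y by (simp only: c.S.m_ac c.S.m_closed c.hom_closed)
    then show ?thesis using t yy by simp
  qed
  have "(?B \<oplus>\<^bsub>Ruv R\<^esub> ?e) [^]\<^bsub>Ruv R\<^esub> (3::nat) = ?B [^]\<^bsub>Ruv R\<^esub> (3::nat) \<oplus>\<^bsub>Ruv R\<^esub>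
      (?B \<otimes>\<^bsub>Ruv R\<^esub> ?B \<otimes>\<^bsub>Ruv R\<^esub> ?e \<oplus>\<^bsub>Ruv R\<^esub> ?B \<otimes>\<^bsub>Ruv R\<^esub> ?B \<otimes>\<^bsub>Ruv R\<^esub> ?e \<oplus>\<^bsub>Ruv R\<^esub>
        ?B \<otimes>\<^bsub>Ruv R\<^esub> ?B \<otimes>\<^bsub>Ruv R\<^esub> ?e)"
    using b e ee by (intro c.S.cube_of_square_zero_shift) auto
  also have "?B \<otimes>\<^bsub>Ruv R\<^esub> ?B \<otimes>\<^bsub>Ruv R\<^esub> ?e \<oplus>\<^bsub>Ruv R\<^esub> ?B \<otimes>\<^bsub>Ruv R\<^esub> ?B \<otimes>\<^bsub>Ruv R\<^esub> ?e \<oplus>\<^bsub>Ruv R\<^esub>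
        ?B \<otimes>\<^bsub>Ruv R\<^esub> ?B \<otimes>\<^bsub>Ruv R\<^esub> ?e =
      Ruv_const R (b \<otimes> b \<otimes> t \<oplus> b \<otimes> b \<otimes> t \<oplus> b \<otimes> b \<otimes> t) \<otimes>\<^bsub>Ruv R\<^esub> y"
    using b t y by (simp add: c.S.l_distr c.S.m_assoc)
  also have "\<dots> = Ruv_const R d \<otimes>\<^bsub>Ruv R\<^esub> y" by (simp only: bt)
  finally have "(?B \<oplus>\<^bsub>Ruv R\<^esub> ?e) [^]\<^bsub>Ruv R\<^esub> (3::nat) = elem_uv R (b [^] (3::nat)) d"
    using b d Ruv_closed by (simp add: elem_uv_def y_def c.S.m_assoc)
  then show ?thesis unfolding is_cube_def using b e by blast
qed

section \<open>The constacyclic quotient\<close>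

text \<open>
The situation of the theorem after the reduction to \<open>F\<close>: finiteness of \<open>F\<close> has been spent on the
relation between \<open>\<alpha>0\<close> and \<open>\<alpha>1\<close>, and the hypothesis on \<open>\<alpha>1 + \<alpha>4 uv\<close> on \<open>\<alpha>0\<close> not being a cube.
The abbreviations name the classes in \<open>A\<close> of \<open>u\<close>, \<open>v\<close>, \<open>x\<close>, of the constants of \<open>F\<close> and of \<open>x\<^sup>3 - \<alpha>0\<close>.
\<close>
locale constacyclic = field F for F (structure) +
  fixes p n :: nat and \<alpha>0 \<alpha>1 \<alpha>4
  assumes p: "Factorial_Ring.prime p" and char_p: "add_pow F p \<one> = \<zero>"
    and \<alpha>0: "\<alpha>0 \<in> carrier F" and \<alpha>4: "\<alpha>4 \<in> carrier F"
    and \<alpha>1: "\<alpha>1 = \<alpha>0 [^] (p ^ n)" and non_cube: "\<not> is_cube F \<alpha>0"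
begin

abbreviation "S \<equiv> Ruv F"
abbreviation "SX \<equiv> UP (Ruv F)"
abbreviation "A \<equiv> constacyclic_ring F (3 * p ^ n) \<alpha>1 \<alpha>4"
abbreviation "cls \<equiv> constacyclic_class F (3 * p ^ n) \<alpha>1 \<alpha>4"
abbreviation "U \<equiv> cls (up_ring.monom SX (Ruv_u F) 0)"
abbreviation "V \<equiv> cls (up_ring.monom SX (Ruv_v F) 0)"
abbreviation "\<xi> \<equiv> cls (up_ring.monom SX \<one>\<^bsub>S\<^esub> (Suc 0))"
abbreviation "scalar a \<equiv> cls (up_ring.monom SX (Ruv_const F a) 0)"
abbreviation "B \<equiv> cls (binomial_poly S 3 (Ruv_const F \<alpha>0))"
abbreviation "M \<equiv> Idl\<^bsub>A\<^esub> {B, U, V}"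

sublocale S: cring S by (rule Ruv_cring)

sublocale SX: UP_cring S SX by (intro UP_cring.intro S.is_cring) simp

sublocale con: ring_hom_cring F S "Ruv_const F"
  by (rule ring_hom_cringI[OF is_cring S.is_cring Ruv_const_hom])

lemma \<alpha>1_closed: "\<alpha>1 \<in> carrier F"
  using \<alpha>0 \<alpha>1 by simp

lemma elem_uv_closed: "elem_uv F \<alpha>1 \<alpha>4 \<in> carrier S"
  using \<alpha>1_closed \<alpha>4 Ruv_closed unfolding elem_uv_def by simp

lemma modulus_ideal: "ideal (constacyclic_ideal F (3 * p ^ n) \<alpha>1 \<alpha>4) SX"
  unfolding constacyclic_ideal_def
  by (rule SX.P.genideal_ideal) (simp add: elem_uv_closed)

sublocale A: cring A
  unfolding constacyclic_ring_def
  by (rule ideal.quotient_is_cring[OF modulus_ideal SX.P.is_cring])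

sublocale cls: ring_hom_cring SX A cls
proof (rule ring_hom_cringI[OF SX.P.is_cring A.is_cring])
  show "cls \<in> ring_hom SX A"
    using ideal.rcos_ring_hom[OF modulus_ideal]
    unfolding constacyclic_ring_def constacyclic_class_def[abs_def] .
qed

lemma cls_eq_zero_iff:
  assumes "f \<in> carrier SX"
  shows "cls f = \<zero>\<^bsub>A\<^esub> \<longleftrightarrow> f \<in> constacyclic_ideal F (3 * p ^ n) \<alpha>1 \<alpha>4"
proof -
  have "\<zero>\<^bsub>A\<^esub> = constacyclic_ideal F (3 * p ^ n) \<alpha>1 \<alpha>4" by (simp add: constacyclic_ring_def FactRing_def)
  then show ?thesis
    using ideal.rcos_const_imp_mem[OF modulus_ideal assms] SX.P.a_rcos_zero[OF modulus_ideal]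
    by (auto simp: constacyclic_class_def)
qed

lemma cls_const_eq_zero:
  assumes r: "r \<in> carrier S" and z: "cls (up_ring.monom SX r 0) = \<zero>\<^bsub>A\<^esub>"
  shows "r = \<zero>\<^bsub>S\<^esub>"
proof (rule SX.const_mem_binomial_ideal[OF elem_uv_closed r])
  show "0 < 3 * p ^ n" using p by (simp add: prime_gt_0_nat)
  show "up_ring.monom SX r 0 \<in> Idl\<^bsub>SX\<^esub> {binomial_poly S (3 * p ^ n) (elem_uv F \<alpha>1 \<alpha>4)}"
    using z r by (simp add: cls_eq_zero_iff constacyclic_ideal_def)
qed

lemma UV_closed: "U \<in> carrier A" "V \<in> carrier A" "\<xi> \<in> carrier A" "B \<in> carrier A"
  using Ruv_closed \<alpha>0 by simp_all

lemma cls_const_mult: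
  assumes "r \<in> carrier S" "t \<in> carrier S"
  shows "cls (up_ring.monom SX r 0) \<otimes>\<^bsub>A\<^esub> cls (up_ring.monom SX t 0) =
    cls (up_ring.monom SX (r \<otimes>\<^bsub>S\<^esub> t) 0)"
  using assms SX.monom_mult[of r t 0 0] by simp

lemma UV_squares: "U \<otimes>\<^bsub>A\<^esub> U = \<zero>\<^bsub>A\<^esub>" "V \<otimes>\<^bsub>A\<^esub> V = \<zero>\<^bsub>A\<^esub>"
  using Ruv_closed by (simp_all add: cls_const_mult Ruv_squares)

lemma UV_nonzero: "U \<otimes>\<^bsub>A\<^esub> V \<noteq> \<zero>\<^bsub>A\<^esub>"
  using cls_const_eq_zero[of "Ruv_u F \<otimes>\<^bsub>S\<^esub> Ruv_v F"] Ruv_uv_nonzero Ruv_closed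
  by (auto simp: cls_const_mult)

lemma A_nontrivial: "\<one>\<^bsub>A\<^esub> \<noteq> \<zero>\<^bsub>A\<^esub>"
  using UV_nonzero UV_closed by (metis A.l_null A.l_one A.m_closed)

sublocale scalar: ring_hom_cring F A scalar
proof (rule ring_hom_cringI[OF is_cring A.is_cring])
  have "scalar = cls \<circ> ((\<lambda>r. up_ring.monom SX r 0) \<circ> Ruv_const F)" by (simp add: fun_eq_iff)
  then show "scalar \<in> ring_hom F A"
    using ring_hom_trans[OF ring_hom_trans[OF Ruv_const_hom SX.const_ring_hom] cls.homh]
    by simp
qed

sublocale ev: UP_univ_prop F A scalar "UP F" \<xi> "UnivPoly.eval F A scalar \<xi>"
  by unfold_locales (use UV_closed in auto)

lemma A_char_p: "add_pow A p \<one>\<^bsub>A\<^esub> = \<zero>\<^bsub>A\<^esub>"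
  using scalar.ring.hom_add_pow[of \<one> p] char_p by simp

lemma xi_power: "cls (up_ring.monom SX \<one>\<^bsub>S\<^esub> k) = \<xi> [^]\<^bsub>A\<^esub> k"
proof -
  have "up_ring.monom SX \<one>\<^bsub>S\<^esub> k = up_ring.monom SX \<one>\<^bsub>S\<^esub> (Suc 0) [^]\<^bsub>SX\<^esub> k"
    by (simp add: SX.monom_pow)
  then show ?thesis by simp
qed

lemma xi_power_modulus:
  "\<xi> [^]\<^bsub>A\<^esub> (3 * p ^ n) = scalar \<alpha>1 \<oplus>\<^bsub>A\<^esub> scalar \<alpha>4 \<otimes>\<^bsub>A\<^esub> (U \<otimes>\<^bsub>A\<^esub> V)"
proof -
  let ?f = "binomial_poly S (3 * p ^ n) (elem_uv F \<alpha>1 \<alpha>4)"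
  have "?f \<in> constacyclic_ideal F (3 * p ^ n) \<alpha>1 \<alpha>4"
    unfolding constacyclic_ideal_def by (rule SX.P.genideal_self') (simp add: elem_uv_closed)
  then have "cls ?f = \<zero>\<^bsub>A\<^esub>" by (subst cls_eq_zero_iff) (simp_all add: elem_uv_closed)
  moreover have "cls ?f = \<xi> [^]\<^bsub>A\<^esub> (3 * p ^ n) \<ominus>\<^bsub>A\<^esub> cls (up_ring.monom SX (elem_uv F \<alpha>1 \<alpha>4) 0)"
    unfolding binomial_poly_def xi_power[symmetric]
    by (simp add: SX.P.minus_eq A.minus_eq elem_uv_closed)
  ultimately have "\<xi> [^]\<^bsub>A\<^esub> (3 * p ^ n) = cls (up_ring.monom SX (elem_uv F \<alpha>1 \<alpha>4) 0)"
    using elem_uv_closed by simp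
  also have "\<dots> = scalar \<alpha>1 \<oplus>\<^bsub>A\<^esub> scalar \<alpha>4 \<otimes>\<^bsub>A\<^esub> (U \<otimes>\<^bsub>A\<^esub> V)"
    using \<alpha>1_closed \<alpha>4 Ruv_closed
    by (simp add: elem_uv_def cls_const_mult S.m_assoc)
  finally show ?thesis .
qed

lemma B_eq: "B = \<xi> [^]\<^bsub>A\<^esub> (3::nat) \<ominus>\<^bsub>A\<^esub> scalar \<alpha>0"
  using \<alpha>0 unfolding binomial_poly_def xi_power[symmetric]
  by (simp add: SX.P.minus_eq A.minus_eq)

text \<open>
Frobenius turns \<open>x\<^sup>3 - \<alpha>0\<close> into \<open>x ^ (3 p ^ n) - \<alpha>1\<close>, which is \<open>\<alpha>4 uv\<close> in \<open>A\<close>.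
\<close>
lemma B_power: "B [^]\<^bsub>A\<^esub> (p ^ n) = scalar \<alpha>4 \<otimes>\<^bsub>A\<^esub> (U \<otimes>\<^bsub>A\<^esub> V)"
proof -
  have cl: "scalar \<alpha>1 \<in> carrier A" "scalar \<alpha>4 \<otimes>\<^bsub>A\<^esub> (U \<otimes>\<^bsub>A\<^esub> V) \<in> carrier A"
    using \<alpha>1_closed \<alpha>4 UV_closed by simp_all
  have "B [^]\<^bsub>A\<^esub> (p ^ n) = (\<xi> [^]\<^bsub>A\<^esub> (3::nat)) [^]\<^bsub>A\<^esub> (p ^ n) \<ominus>\<^bsub>A\<^esub> scalar \<alpha>0 [^]\<^bsub>A\<^esub> (p ^ n)"
    unfolding B_eq
    by (rule A.frobenius_minus_power[OF p A_char_p]) (use \<alpha>0 UV_closed in auto)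
  also have "(\<xi> [^]\<^bsub>A\<^esub> (3::nat)) [^]\<^bsub>A\<^esub> (p ^ n) = \<xi> [^]\<^bsub>A\<^esub> (3 * p ^ n)"
    by (rule A.nat_pow_pow) (rule UV_closed)
  also have "scalar \<alpha>0 [^]\<^bsub>A\<^esub> (p ^ n) = scalar \<alpha>1"
    using scalar.hom_pow[OF \<alpha>0, of "p ^ n"] by (simp only: \<alpha>1[symmetric])
  finally show ?thesis
    unfolding xi_power_modulus using cl
    by (simp only: A.minus_eq A.a_comm[of "scalar \<alpha>1"] A.a_assoc A.a_inv_closed A.r_neg A.r_zero)
qed

lemma generators_nilpotent:
  assumes "x \<in> {B, U, V}"
  shows "\<exists>k. x [^]\<^bsub>A\<^esub> (p ^ k) = \<zero>\<^bsub>A\<^esub>"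
proof -
  have sq: "x [^]\<^bsub>A\<^esub> p = \<zero>\<^bsub>A\<^esub>" if x: "x \<in> carrier A" "x \<otimes>\<^bsub>A\<^esub> x = \<zero>\<^bsub>A\<^esub>" for x
  proof -
    have "x [^]\<^bsub>A\<^esub> Suc (Suc (p - 2)) = \<zero>\<^bsub>A\<^esub>" using x by (simp add: A.m_assoc)
    moreover have "Suc (Suc (p - 2)) = p" using prime_ge_2_nat[OF p] by simp
    ultimately show ?thesis by (simp only:)
  qed
  have "(scalar \<alpha>4 \<otimes>\<^bsub>A\<^esub> (U \<otimes>\<^bsub>A\<^esub> V)) \<otimes>\<^bsub>A\<^esub> (scalar \<alpha>4 \<otimes>\<^bsub>A\<^esub> (U \<otimes>\<^bsub>A\<^esub> V)) =
      (scalar \<alpha>4 \<otimes>\<^bsub>A\<^esub> scalar \<alpha>4 \<otimes>\<^bsub>A\<^esub> (V \<otimes>\<^bsub>A\<^esub> V)) \<otimes>\<^bsub>A\<^esub> (U \<otimes>\<^bsub>A\<^esub> U)"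
    using scalar.hom_closed[OF \<alpha>4] UV_closed by (simp only: A.m_ac A.m_closed)
  also have "\<dots> = \<zero>\<^bsub>A\<^esub>" using scalar.hom_closed[OF \<alpha>4] UV_closed by (simp only: UV_squares A.r_null A.m_closed A.zero_closed)
  finally have "(B [^]\<^bsub>A\<^esub> (p ^ n)) [^]\<^bsub>A\<^esub> p = \<zero>\<^bsub>A\<^esub>"
    unfolding B_power by (intro sq) (use scalar.hom_closed[OF \<alpha>4] UV_closed in auto)
  then have "B [^]\<^bsub>A\<^esub> (p ^ Suc n) = \<zero>\<^bsub>A\<^esub>"
    using UV_closed by (simp add: A.nat_pow_pow mult.commute)
  moreover have "U [^]\<^bsub>A\<^esub> (p ^ 1) = \<zero>\<^bsub>A\<^esub>" "V [^]\<^bsub>A\<^esub> (p ^ 1) = \<zero>\<^bsub>A\<^esub>"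
    using sq UV_squares UV_closed by simp_all
  ultimately show ?thesis using assms by blast
qed

lemma M_ideal: "ideal M A"
  by (rule A.genideal_ideal) (use UV_closed in auto)

lemma generators_mem: "B \<in> M" "U \<in> M" "V \<in> M"
  using A.genideal_self[of "{B, U, V}"] UV_closed by auto

text \<open>
All generators of \<open>M\<close> are nilpotent, so \<open>M\<close> lies in the nilradical, which does not contain \<open>\<one>\<close>.
\<close>
lemma M_proper: "M \<noteq> carrier A"
proof
  let ?N = "{x \<in> carrier A. \<exists>k. x [^]\<^bsub>A\<^esub> (p ^ k) = \<zero>\<^bsub>A\<^esub>}"
  have "M \<subseteq> ?N"
    by (rule A.genideal_minimal[OF A.char_p_nilpotents_ideal[OF p A_char_p]])
      (use generators_nilpotent UV_closed in blast)
  moreover assume "M = carrier A"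
  ultimately have "\<one>\<^bsub>A\<^esub> \<in> ?N" using A.one_closed by blast
  then show False using A_nontrivial by simp
qed

abbreviation "ev \<equiv> UnivPoly.eval F A scalar \<xi>"

text \<open>
Modulo \<open>u\<close> and \<open>v\<close> every coefficient of a polynomial over \<open>S\<close> can be replaced by an element of
\<open>F\<close>. The elements \<open>T\<close> of \<open>A\<close> reached in this way are closed under sums and products and
contain the constants and the powers of the class of \<open>x\<close>, hence all of \<open>A\<close>.
\<close>
lemma ev_onto_modulo_M:
  assumes y: "y \<in> carrier A"
  shows "\<exists>g\<in>carrier (UP F). y \<ominus>\<^bsub>A\<^esub> ev g \<in> M"
proof -
  interpret M: ideal M A by (rule M_ideal)
  define T where "T = {y \<in> carrier A. \<exists>g\<in>carrier (UP F). y \<ominus>\<^bsub>A\<^esub> ev g \<in> M}"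
  have add: "y \<oplus>\<^bsub>A\<^esub> z \<in> T" if "y \<in> T" "z \<in> T" for y z
  proof -
    from that obtain g g' where yz: "y \<in> carrier A" "z \<in> carrier A"
      and g: "g \<in> carrier (UP F)" "g' \<in> carrier (UP F)"
      and mem: "y \<ominus>\<^bsub>A\<^esub> ev g \<in> M" "z \<ominus>\<^bsub>A\<^esub> ev g' \<in> M"
      unfolding T_def by blast
    show ?thesis
      using ev.ring.image_modulo_add[OF M_ideal g yz mem] A.a_closed[OF yz] ev.P.a_closed[OF g]
      unfolding T_def by blast
  qed
  have mult: "y \<otimes>\<^bsub>A\<^esub> z \<in> T" if "y \<in> T" "z \<in> T" for y z
  proof -
    from that obtain g g' where yz: "y \<in> carrier A" "z \<in> carrier A"
      and g: "g \<in> carrier (UP F)" "g' \<in> carrier (UP F)"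
      and mem: "y \<ominus>\<^bsub>A\<^esub> ev g \<in> M" "z \<ominus>\<^bsub>A\<^esub> ev g' \<in> M"
      unfolding T_def by blast
    show ?thesis
      using ev.ring.image_modulo_mult[OF M_ideal g yz mem] A.m_closed[OF yz] ev.P.m_closed[OF g]
      unfolding T_def by blast
  qed
  have img: "ev g \<in> T" if "g \<in> carrier (UP F)" for g
  proof -
    have "ev g \<ominus>\<^bsub>A\<^esub> ev g = \<zero>\<^bsub>A\<^esub>" using that by (simp add: A.minus_eq A.r_neg)
    then have "ev g \<ominus>\<^bsub>A\<^esub> ev g \<in> M" using M.zero_closed by (simp only:)
    then show ?thesis using that ev.hom_closed[OF that] unfolding T_def by blast
  qed
  have memM: "z \<in> T" if "z \<in> M" for z
  proof -
    have z: "z \<in> carrier A" using that M.a_subset by blast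
    then have "z \<ominus>\<^bsub>A\<^esub> ev \<zero>\<^bsub>UP F\<^esub> = z" by (simp add: A.minus_eq)
    then have "z \<ominus>\<^bsub>A\<^esub> ev \<zero>\<^bsub>UP F\<^esub> \<in> M" using that by (simp only:)
    then show ?thesis using z ev.P.zero_closed unfolding T_def by blast
  qed
  have const: "cls (up_ring.monom SX r 0) \<in> T" if r: "r \<in> carrier S" for r
  proof -
    obtain c a b where c: "c \<in> carrier F" and ab: "a \<in> carrier S" "b \<in> carrier S"
      and r_eq: "r = Ruv_const F c \<oplus>\<^bsub>S\<^esub> (Ruv_u F \<otimes>\<^bsub>S\<^esub> a \<oplus>\<^bsub>S\<^esub> Ruv_v F \<otimes>\<^bsub>S\<^esub> b)"
      using Ruv_decomposition[OF _ r] by auto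
    let ?a = "cls (up_ring.monom SX a 0)" and ?b = "cls (up_ring.monom SX b 0)"
    have "cls (up_ring.monom SX r 0) = scalar c \<oplus>\<^bsub>A\<^esub> (U \<otimes>\<^bsub>A\<^esub> ?a \<oplus>\<^bsub>A\<^esub> V \<otimes>\<^bsub>A\<^esub> ?b)"
      using c ab Ruv_closed by (simp add: r_eq cls_const_mult)
    moreover have "U \<otimes>\<^bsub>A\<^esub> ?a \<oplus>\<^bsub>A\<^esub> V \<otimes>\<^bsub>A\<^esub> ?b \<in> M"
      using ab generators_mem by (intro M.a_closed M.I_r_closed) auto
    moreover have "scalar c \<in> T"
      using img[of "up_ring.monom (UP F) c 0"] ev.Eval_monom[of c 0] c by simp
    ultimately show ?thesis using add memM by simp
  qed
  have Xpow: "\<xi> [^]\<^bsub>A\<^esub> k \<in> T" for k :: nat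
    using img[of "up_ring.monom (UP F) \<one> k"] ev.Eval_monom[of \<one> k] UV_closed by simp
  obtain f where f: "f \<in> carrier SX" "y = cls f"
    using y unfolding constacyclic_ring_def FactRing_def A_RCOSETS_def' constacyclic_class_def by auto
  have monom: "cls (up_ring.monom SX r k) \<in> T" if r: "r \<in> carrier S" for r k
  proof -
    have "up_ring.monom SX r k = up_ring.monom SX r 0 \<otimes>\<^bsub>SX\<^esub> up_ring.monom SX \<one>\<^bsub>S\<^esub> k"
      using r SX.monom_mult[of r "\<one>\<^bsub>S\<^esub>" 0 k] by simp
    then have "cls (up_ring.monom SX r k) = cls (up_ring.monom SX r 0) \<otimes>\<^bsub>A\<^esub> \<xi> [^]\<^bsub>A\<^esub> k"
      using r by (simp add: xi_power[symmetric])
    then show ?thesis using mult const[OF r] Xpow by simp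
  qed
  have partial: "cls (\<Oplus>\<^bsub>SX\<^esub>i\<in>{..d}. up_ring.monom SX (up_ring.coeff SX f i) i) \<in> T" for d :: nat
    using f(1) by (induction d) (simp_all add: monom add)
  have "y \<in> T" using partial[of "deg S f"] SX.up_repr[OF f(1)] f(2) by simp
  then show ?thesis by (simp add: T_def)
qed

text \<open>
Evaluation at the class of \<open>x\<close> maps \<open>F[x]\<close> onto \<open>A\<close> modulo \<open>M\<close> and sends \<open>x\<^sup>3 - \<alpha>0\<close> into \<open>M\<close>, so the
maximality of \<open>\<langle>x\<^sup>3 - \<alpha>0\<rangle>\<close> in \<open>F[x]\<close> is inherited by \<open>M\<close>.
\<close>
lemma M_maximal: "maximalideal M A"
proof (rule ev.ring.maximalideal_image_modulo[OF _ M_ideal M_proper])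
  let ?h = "binomial_poly F 3 \<alpha>0"
  interpret F: UP_domain F "UP F" by (intro UP_domain.intro domain_axioms) simp
  show "maximalideal (Idl\<^bsub>UP F\<^esub> {?h}) (UP F)"
    by (rule F.non_cube_maximal[OF field_axioms \<alpha>0 non_cube])
  have "ev ?h = B"
    unfolding B_eq unfolding binomial_poly_def
    using \<alpha>0 ev.Eval_monom[of \<one> 3] ev.Eval_monom[of \<alpha>0 0] UV_closed
    by (simp add: ev.P.minus_eq A.minus_eq)
  then have "?h \<in> {g \<in> carrier (UP F). ev g \<in> M}" using generators_mem \<alpha>0 by simp
  then have "Idl\<^bsub>UP F\<^esub> {?h} \<subseteq> {g \<in> carrier (UP F). ev g \<in> M}"
    by (intro ev.P.genideal_minimal[OF ev.ring.ideal_vimage[OF M_ideal]]) auto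
  then show "ev ` (Idl\<^bsub>UP F\<^esub> {?h}) \<subseteq> M" by auto
qed (rule ev_onto_modulo_M)

lemma maximal_ideals: "{I. maximalideal I A} = {M}"
  by (rule A.nilpotent_generated_maximal_unique[OF _ _ M_maximal])
    (use UV_closed generators_nilpotent in blast)+

lemma A_local: "local_ring A"
  unfolding local_ring_def using A.is_cring maximal_ideals by blast

lemma A_not_chain: "\<not> chain_ring A"
  by (rule A.not_chain_ring_if_square_zero[OF UV_closed(1,2) UV_squares UV_nonzero])

end

theorem lemma6p2:
  fixes F :: "('a, 'b) ring_scheme"
    and p m s q0 r0 :: nat
    and \<alpha>0 \<alpha>1 \<alpha>4 :: 'a
  assumes "Factorial_Ring.prime p" and "p \<noteq> 3" and "0 < m" and "0 < s"
    and "field F" and "card (carrier F) = p ^ m"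
    and "s = q0 * m + r0" and "r0 \<le> m - 1"
    and "\<alpha>1 \<in> carrier F - {\<zero>\<^bsub>F\<^esub>}" and "\<alpha>4 \<in> carrier F - {\<zero>\<^bsub>F\<^esub>}"
    and "\<alpha>0 = \<alpha>1 [^]\<^bsub>F\<^esub> (p ^ (m - r0))"
    and "\<not> is_cube (Ruv F) (elem_uv F \<alpha>1 \<alpha>4)"
  shows "local_ring (constacyclic_ring F (3 * p ^ s) \<alpha>1 \<alpha>4) \<and>
    {M. maximalideal M (constacyclic_ring F (3 * p ^ s) \<alpha>1 \<alpha>4)} =
      {Idl\<^bsub>constacyclic_ring F (3 * p ^ s) \<alpha>1 \<alpha>4\<^esub>
        {constacyclic_class F (3 * p ^ s) \<alpha>1 \<alpha>4 (binomial_poly (Ruv F) 3 (Ruv_const F \<alpha>0)),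
         constacyclic_class F (3 * p ^ s) \<alpha>1 \<alpha>4 (monom (UP (Ruv F)) (Ruv_u F) 0),
         constacyclic_class F (3 * p ^ s) \<alpha>1 \<alpha>4 (monom (UP (Ruv F)) (Ruv_v F) 0)}} \<and>
    \<not> chain_ring (constacyclic_ring F (3 * p ^ s) \<alpha>1 \<alpha>4)"
proof -
  interpret F: field F by (rule assms(5))
  have \<alpha>1: "\<alpha>1 \<in> carrier F" "\<alpha>1 \<noteq> \<zero>\<^bsub>F\<^esub>" and \<alpha>4: "\<alpha>4 \<in> carrier F" using assms(9,10) by auto
  have "0 < card (carrier F)" using assms(1,6) by (simp add: prime_gt_0_nat)
  then have fin: "finite (carrier F)" by (simp add: card_gt_0_iff)
  have ch: "add_pow F p \<one>\<^bsub>F\<^esub> = \<zero>\<^bsub>F\<^esub>" by (rule F.char_of_card[OF assms(1,6)])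
  \<comment> \<open>Hence \<open>\<alpha>0 ^ (p ^ s)\<close> is \<open>\<alpha>1\<close> raised to a power of \<open>card F\<close>, which fixes every element of \<open>F\<close>.\<close>
  have "m - r0 + s = m * (q0 + 1)" using assms(3,7,8) by simp
  then have pw: "p ^ (m - r0) * p ^ s = (p ^ m) ^ (q0 + 1)"
    by (metis power_add power_mult)
  have root: "\<alpha>0 [^]\<^bsub>F\<^esub> (p ^ s) = \<alpha>1"
    using F.pow_card_power[OF fin \<alpha>1(1), of "q0 + 1"] \<alpha>1(1)
    unfolding assms(11) assms(6) by (simp only: F.nat_pow_pow pw)
  \<comment> \<open>A cube root of \<open>\<alpha>0\<close> would give one of \<open>\<alpha>1 = \<alpha>0 ^ (p ^ s)\<close>, and then one of \<open>\<alpha>1 + \<alpha>4 uv\<close>.\<close>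
  have "\<not> is_cube F \<alpha>0"
  proof
    assume "is_cube F \<alpha>0"
    then obtain b where b: "b \<in> carrier F" "b [^]\<^bsub>F\<^esub> (3::nat) = \<alpha>0" unfolding is_cube_def by blast
    define c where "c = b [^]\<^bsub>F\<^esub> (p ^ s)"
    have c: "c \<in> carrier F" using b by (simp add: c_def)
    have "c [^]\<^bsub>F\<^esub> (3::nat) = (b [^]\<^bsub>F\<^esub> (3::nat)) [^]\<^bsub>F\<^esub> (p ^ s)"
      using b(1) by (simp add: c_def F.nat_pow_pow mult.commute)
    then have c3: "c [^]\<^bsub>F\<^esub> (3::nat) = \<alpha>1" using b(2) root by simp
    have "c \<noteq> \<zero>\<^bsub>F\<^esub>" using c3 \<alpha>1(2) by (auto simp: F.nat_pow_zero)
    moreover have "coprime 3 p" using assms(1,2) by (simp add: primes_coprime)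
    then have "add_pow F (3::nat) \<one>\<^bsub>F\<^esub> \<noteq> \<zero>\<^bsub>F\<^esub>"
      using F.coprime_multiples_of_one_zero[of 3 p] ch F.one_not_zero by blast
    ultimately have "is_cube (Ruv F) (elem_uv F (c [^]\<^bsub>F\<^esub> (3::nat)) \<alpha>4)"
      using F.elem_uv_is_cube c \<alpha>4 by blast
    then show False using c3 assms(12) by simp
  qed
  then interpret constacyclic F p s \<alpha>0 \<alpha>1 \<alpha>4
    by unfold_locales (use assms(1,11) ch \<alpha>1 \<alpha>4 root in auto)
  show ?thesis using A_local maximal_ideals A_not_chain by blast
qed

end
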